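(* Let $F$ be an algebraically closed field with $\operatorname{char}(F)=0$, let $A=M_n(F)$ with $n\ge 2$, and let $f\in F\langle \mathcal X\rangle$ be a polynomial which is neither an identity nor a central polynomial of $A$. Then every traceless matrix (i.e. matrix with trace $0$) in $A$ is a sum of four matrices from $f(A)-f(A)$.
   Context: $F\langle \mathcal X\rangle$ is the free (unital, associative) algebra over $F$ on $\mathcal X=\{X_1,X_2,\dots\}$, i.e. the algebra of noncommutative polynomials. For $f=f(X_1,\dots,X_m)$, $f(A)=\{f(a_1,\dots,a_m)\mid a_1,\dots,a_m\in A\}$ and $f(A)-f(A)=\{t-t'\mid t,t'\in f(A)\}$. $f$ is an identity of $A$ if $f(A)=\{0\}$; $f$ is a central polynomial of $A$ if $f(A)$ is contained in the center of $A$ but $f$ is not an identity of $A$ (a nonzero constant term is allowed). *)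

theory Defs
  imports
    "Jordan_Normal_Form.Matrix"
    "HOL-Library.Poly_Mapping"
    "HOL-Computational_Algebra.Polynomial"
begin

text \<open>
  The free monoid: with words added by concatenation, the convolution product of
  \<^theory>\<open>HOL-Library.Poly_Mapping\<close> makes \<open>nat list \<Rightarrow>\<^sub>0 'a\<close> the monoid algebra of the free
  monoid on countably many letters, i.e. the free unital associative algebra. The letter
  \<open>i\<close> stands for the variable $X_{i+1}$; a polynomial involves only finitely many of them.
\<close>

instantiation list :: (type) monoid_add
begin

definition zero_list :: "'a list" where "zero_list = []"

definition plus_list :: "'a list \<Rightarrow> 'a list \<Rightarrow> 'a list" where "plus_list = (@)"

instance
  by standard (simp_all add: zero_list_def plus_list_def)

end

type_synonym 'a free_algebra = "nat list \<Rightarrow>\<^sub>0 'a"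

definition word_eval :: "nat \<Rightarrow> (nat \<Rightarrow> 'a::comm_ring_1 mat) \<Rightarrow> nat list \<Rightarrow> 'a mat" where
  "word_eval n a w = foldr (\<lambda>i M. a i * M) w (1\<^sub>m n)"

definition free_eval :: "nat \<Rightarrow> (nat \<Rightarrow> 'a::comm_ring_1 mat) \<Rightarrow> 'a free_algebra \<Rightarrow> 'a mat" where
  "free_eval n a f =
     finsum (module_mat TYPE('a) n n) (\<lambda>w. Poly_Mapping.lookup f w \<cdot>\<^sub>m word_eval n a w) (Poly_Mapping.keys f)"

text \<open>
  A value \<open>f(a\<^sub>1, \<dots>, a\<^sub>m)\<close> depends only on the matrices substituted for the variables that occur
  in \<open>f\<close>, so assigning a matrix to every variable yields the same set of values for every
  admissible \<open>m\<close>.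
\<close>

definition poly_image :: "nat \<Rightarrow> 'a::comm_ring_1 free_algebra \<Rightarrow> 'a mat set" where
  "poly_image n f = {free_eval n a f | a. \<forall>i. a i \<in> carrier_mat n n}"

definition poly_image_diff :: "nat \<Rightarrow> 'a::comm_ring_1 free_algebra \<Rightarrow> 'a mat set" where
  "poly_image_diff n f = {t - t' | t t'. t \<in> poly_image n f \<and> t' \<in> poly_image n f}"

definition mat_center :: "nat \<Rightarrow> 'a::comm_ring_1 mat set" where
  "mat_center n = {Z \<in> carrier_mat n n. \<forall>B \<in> carrier_mat n n. Z * B = B * Z}"

definition polynomial_identity :: "nat \<Rightarrow> 'a::comm_ring_1 free_algebra \<Rightarrow> bool" where
  "polynomial_identity n f \<longleftrightarrow> poly_image n f = {0\<^sub>m n n}"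

definition central_polynomial :: "nat \<Rightarrow> 'a::comm_ring_1 free_algebra \<Rightarrow> bool" where
  "central_polynomial n f \<longleftrightarrow> poly_image n f \<subseteq> mat_center n \<and> \<not> polynomial_identity n f"

definition mat_trace :: "'a::comm_ring_1 mat \<Rightarrow> 'a" where
  "mat_trace A = sum_list (diag_mat A)"

text \<open>
  \<open>free_eval n a\<close> is the unital algebra homomorphism into the \<open>n \<times> n\<close> matrices that sends
  the \<open>i\<close>-th variable to \<open>a i\<close>.
\<close>

lemma word_eval_carrier [simp]:
  assumes "\<forall>i. a i \<in> carrier_mat n n"
  shows "word_eval n a w \<in> carrier_mat n n"
  using assms by (induction w) (auto simp: word_eval_def intro: mult_carrier_mat)

lemma word_eval_append:
  assumes "\<forall>i. a i \<in> carrier_mat n n"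
  shows "word_eval n a (u @ v) = word_eval n a u * word_eval n a v"
proof (induction u)
  case Nil
  show ?case
    using word_eval_carrier[OF assms, where w = v] by (simp add: word_eval_def)
next
  case (Cons i u)
  have "word_eval n a ((i # u) @ v) = a i * (word_eval n a u * word_eval n a v)"
    using Cons by (simp add: word_eval_def)
  also have "\<dots> = (a i * word_eval n a u) * word_eval n a v"
    by (rule assoc_mult_mat[symmetric, OF assms[rule_format] word_eval_carrier[OF assms] word_eval_carrier[OF assms]])
  finally show ?case by (simp add: word_eval_def)
qed

lemma free_eval_superset:
  fixes a :: "nat \<Rightarrow> 'a::comm_ring_1 mat"
  assumes a: "\<forall>i. a i \<in> carrier_mat n n" and S: "finite S" "Poly_Mapping.keys f \<subseteq> S"
  shows "free_eval n a f = mat n n (\<lambda>ij. \<Sum>w\<in>S. Poly_Mapping.lookup f w * word_eval n a w $$ ij)"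
proof -
  interpret M: abelian_group "module_mat TYPE('a) n n" by (rule abelian_group_mat)
  let ?g = "\<lambda>w. Poly_Mapping.lookup f w \<cdot>\<^sub>m word_eval n a w"
  have c: "word_eval n a w \<in> carrier_mat n n" for w by (rule word_eval_carrier[OF a])
  have *: "finsum (module_mat TYPE('a) n n) ?g K
             = mat n n (\<lambda>ij. \<Sum>w\<in>K. Poly_Mapping.lookup f w * word_eval n a w $$ ij)" if "finite K" for K
    using that
  proof (induction K rule: finite_induct)
    case empty
    show ?case by (auto simp: module_mat_simps)
  next
    case (insert w K)
    have "finsum (module_mat TYPE('a) n n) ?g (insert w K)
            = ?g w + finsum (module_mat TYPE('a) n n) ?g K"
      using M.finsum_insert[of K w ?g] insert.hyps c by (simp add: module_mat_simps Pi_def)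
    also have "\<dots> = mat n n (\<lambda>ij. \<Sum>w\<in>insert w K. Poly_Mapping.lookup f w * word_eval n a w $$ ij)"
      using insert c[of w] by (intro eq_matI) auto
    finally show ?case .
  qed
  have "(\<Sum>w\<in>Poly_Mapping.keys f. Poly_Mapping.lookup f w * word_eval n a w $$ ij)
          = (\<Sum>w\<in>S. Poly_Mapping.lookup f w * word_eval n a w $$ ij)" for ij
    using S by (intro sum.mono_neutral_left) (auto simp: in_keys_iff)
  then show ?thesis
    by (simp add: free_eval_def *)
qed

lemma free_eval_carrier [simp]:
  assumes "\<forall>i. a i \<in> carrier_mat n n"
  shows "free_eval n a f \<in> carrier_mat n n"
  by (subst free_eval_superset[OF assms finite_keys order_refl]) auto

lemma free_eval_single:
  assumes "\<forall>i. a i \<in> carrier_mat n n"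
  shows "free_eval n a (Poly_Mapping.single w c) = c \<cdot>\<^sub>m word_eval n a w"
  using word_eval_carrier[OF assms, where w = w]
  by (subst free_eval_superset[OF assms, where S = "{w}"]) (auto intro!: eq_matI)

lemma free_eval_zero:
  assumes "\<forall>i. a i \<in> carrier_mat n n"
  shows "free_eval n a 0 = 0\<^sub>m n n"
  by (subst free_eval_superset[OF assms, where S = "{}"]) auto

lemma free_eval_one:
  assumes "\<forall>i. a i \<in> carrier_mat n n"
  shows "free_eval n a 1 = 1\<^sub>m n"
  by (simp flip: single_one add: free_eval_single[OF assms] word_eval_def zero_list_def)
    (auto intro!: eq_matI)

lemma free_eval_variable:
  assumes "\<forall>i. a i \<in> carrier_mat n n"
  shows "free_eval n a (Poly_Mapping.single [i] 1) = a i"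
  using assms[rule_format, of i] by (auto simp: free_eval_single[OF assms] word_eval_def intro!: eq_matI)

lemma free_eval_add:
  assumes a: "\<forall>i. a i \<in> carrier_mat n n"
  shows "free_eval n a (f + g) = free_eval n a f + free_eval n a g"
proof -
  let ?S = "Poly_Mapping.keys f \<union> Poly_Mapping.keys g"
  have "Poly_Mapping.keys (f + g) \<subseteq> ?S" by (rule keys_add)
  then show ?thesis
    by (simp add: free_eval_superset[OF a, where S = ?S])
      (auto intro!: eq_matI simp: lookup_add distrib_right sum.distrib)
qed

lemma poly_mapping_single_add_induct:
  fixes f :: "'b \<Rightarrow>\<^sub>0 'c::comm_monoid_add"
  assumes "P 0" and "\<And>w c g. P g \<Longrightarrow> P (Poly_Mapping.single w c + g)"
  shows "P f"
proof (induction f rule: update_induct)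
  case const
  show ?case by (rule assms(1))
next
  case (update f w c)
  have "Poly_Mapping.update w c f = Poly_Mapping.single w c + f"
    using update by (intro poly_mapping_eqI)
      (auto simp: lookup_update lookup_add lookup_single when_def in_keys_iff)
  then show ?case using assms(2) update by simp
qed

lemma free_eval_mult:
  assumes a: "\<forall>i. a i \<in> carrier_mat n n"
  shows "free_eval n a (f * g) = free_eval n a f * free_eval n a g"
proof (induction f rule: poly_mapping_single_add_induct)
  case 1
  show ?case
    using free_eval_carrier[OF a, where f = g] by (simp add: free_eval_zero[OF a])
next
  case (2 u c f)
  note C = free_eval_carrier[OF a] word_eval_carrier[OF a]
  have s: "free_eval n a (Poly_Mapping.single u c * g)
             = free_eval n a (Poly_Mapping.single u c) * free_eval n a g"
  proof (induction g rule: poly_mapping_single_add_induct)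
    case 1
    show ?case
      using C(1)[where f = "Poly_Mapping.single u c"] by (simp add: free_eval_zero[OF a])
  next
    case (2 v d g)
    have "free_eval n a (Poly_Mapping.single u c * Poly_Mapping.single v d)
            = (c * d) \<cdot>\<^sub>m (word_eval n a u * word_eval n a v)"
      by (simp add: mult_single free_eval_single[OF a] plus_list_def word_eval_append[OF a])
    also have "\<dots> = free_eval n a (Poly_Mapping.single u c) * free_eval n a (Poly_Mapping.single v d)"
      using C(2)[where w = u] C(2)[where w = v]
      by (auto simp: free_eval_single[OF a] ac_simps intro!: eq_matI)
    finally show ?case
      using 2 C(1) by (simp add: distrib_left free_eval_add[OF a] mult_add_distrib_mat[OF C(1) C(1) C(1)])
  qed
  show ?case
    using 2 s by (simp add: distrib_right free_eval_add[OF a] add_mult_distrib_mat[OF C(1) C(1) C(1)])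
qed

end

theory Submission
  imports Defs "Jordan_Normal_Form.Jordan_Normal_Form_Existence"
begin

text \<open>
  Put \<open>h = n div 2\<close>. Both \<open>f(A)\<close> and \<open>f(A) - f(A)\<close> are invariant under conjugation, and
  \<open>f(A) - f(A)\<close> contains \<open>[u, X]\<close> for \<open>X\<close> in \<open>f(A)\<close> and \<open>u\<^sup>2 = 0\<close>, since
  \<open>(1 + u/2) X (1 - u/2) - (1 - u/2) X (1 + u/2) = [u, X]\<close>.

  If \<open>f(A)\<close> contains an upper triangular \<open>B\<close> whose diagonal entries at \<open>i\<close> and \<open>h + i\<close> differ
  for all \<open>i < h\<close>, a suitable \<open>[u, B]\<close> has square zero and any prescribed rank at most \<open>h\<close>, so
  \<open>f(A) - f(A)\<close> contains all matrices of square zero. A nilpotent Jordan matrix is the sum of two such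
  matrices (even and odd positions of the superdiagonal), and a traceless matrix is similar to one
  with zero diagonal, which is a sum of two nilpotent matrices: four summands in total.

  To find \<open>B\<close> it suffices that some value of \<open>f\<close> has no eigenvalue of multiplicity above \<open>n/2\<close>.
  Replace the entries \<open>a\<^sub>r\<^sub>s\<close> of the arguments by \<open>q^((s - r) mod n) a\<^sub>r\<^sub>s\<close>. The coefficient of \<open>q\<^sup>J\<close> in
  the value is then supported on the shifted diagonal \<open>s = r + J\<close> modulo \<open>n\<close>. Take the least \<open>J\<close> for which
  this coefficient \<open>X\<close> is not always scalar, and generic arguments. If \<open>n\<close> does not divide \<open>J\<close>, then
  \<open>X\<close> is invertible and similar to \<open>\<zeta> X\<close> with a root of unity \<open>\<zeta> \<noteq> 1\<close>; otherwise \<open>X\<close> is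
  diagonal and, by cyclic symmetry, its equal diagonal entries form classes of size at most \<open>n/2\<close>.
  Either way the multiplicities of \<open>X\<close> are at most \<open>n/2\<close>. Up to a scalar matrix and the factor
  \<open>q\<^sup>J\<close>, the value is a polynomial deformation of \<open>X\<close>, and bounded multiplicity is an open condition.
\<close>

section \<open>Similarity and values of polynomials\<close>

lemma index_mult_mat_sum:
  assumes "A \<in> carrier_mat m n" "B \<in> carrier_mat n k" "i < m" "j < k"
  shows "(A * B) $$ (i, j) = (\<Sum>l<n. A $$ (i, l) * B $$ (l, j))"
  using assms by (auto simp: scalar_prod_def lessThan_atLeast0)

text \<open>Later similarities come from sparse intertwining matrices, for which a nonzero
  determinant is easier to show than an explicit inverse.\<close>

lemma similar_mat_intertwine:
  fixes A B P :: "'a::field mat"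
  assumes "A \<in> carrier_mat n n" "B \<in> carrier_mat n n" and P: "P \<in> carrier_mat n n"
    and det: "det P \<noteq> 0" and AP: "A * P = P * B"
  shows "similar_mat A B"
proof -
  obtain Q where Q: "Q \<in> carrier_mat n n" "Q * P = 1\<^sub>m n" "P * Q = 1\<^sub>m n"
    using det_non_zero_imp_unit[OF P det, of "()"] by (auto simp: Units_def ring_mat_def)
  have "P * B * Q = A * (P * Q)"
    using assms(1) P Q by (simp flip: AP)
  then have "A = P * B * Q" using assms(1) Q by simp
  then show ?thesis
    by (intro similar_matI[of _ _ P Q n]) (use assms Q in auto)
qed

text \<open>A singular matrix over a field has a nonzero kernel vector. Kernel vectors are taken as
  functions, so that for sparse matrices each row equation collapses to a few terms.\<close>

lemma det_nonzeroI:
  fixes P :: "'a::field mat"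
  assumes P: "P \<in> carrier_mat n n"
    and inj: "\<And>x. (\<And>i. i < n \<Longrightarrow> (\<Sum>j<n. P $$ (i, j) * x j) = 0) \<Longrightarrow> \<forall>j<n. x j = 0"
  shows "det P \<noteq> 0"
proof
  assume "det P = 0"
  then obtain v where v: "v \<in> carrier_vec n" "v \<noteq> 0\<^sub>v n" "P *\<^sub>v v = 0\<^sub>v n"
    using det_0_iff_vec_prod_zero_field[OF P] by auto
  have "(\<Sum>j<n. P $$ (i, j) * v $ j) = 0" if "i < n" for i
    using arg_cong[OF v(3), of "\<lambda>w. w $ i"] that P v(1)
    by (simp add: scalar_prod_def lessThan_atLeast0)
  from inj[OF this] have "v = 0\<^sub>v n"
    using v(1) by auto
  with v(2) show False by simp
qed

lemma similar_mat_permute: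
  fixes M :: "'a::field mat"
  assumes M: "M \<in> carrier_mat n n" and \<pi>: "bij_betw \<pi> {..<n} {..<n}"
  shows "similar_mat (mat n n (\<lambda>(i, j). M $$ (\<pi> i, \<pi> j))) M"
proof -
  \<comment> \<open>Row \<open>i\<close> of this permutation matrix selects coordinate
    \<open>\<pi> i\<close>.\<close>
  define P :: "'a mat" where "P = mat n n (\<lambda>(i, j). if \<pi> i = j then 1 else 0)"
  have P: "P \<in> carrier_mat n n" by (simp add: P_def)
  have \<pi>n: "\<pi> i < n" if "i < n" for i using \<pi> that by (auto simp: bij_betw_def)
  show ?thesis
  proof (rule similar_mat_intertwine[OF _ M P])
    show "det P \<noteq> 0"
    proof (rule det_nonzeroI[OF P])
      fix x assume x: "\<And>i. i < n \<Longrightarrow> (\<Sum>j<n. P $$ (i, j) * x j) = 0"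
      have "x (\<pi> i) = 0" if "i < n" for i
        using x[OF that] that \<pi>n[OF that] by (simp add: P_def if_distrib if_distribR sum.delta' cong: if_cong)
      then show "\<forall>j<n. x j = 0" using bij_betw_imp_surj_on[OF \<pi>] by (metis imageE lessThan_iff)
    qed
    show "mat n n (\<lambda>(i, j). M $$ (\<pi> i, \<pi> j)) * P = P * M"
    proof (rule eq_matI)
      fix i j assume "i < dim_row (P * M)" "j < dim_col (P * M)"
      then have ij: "i < n" "j < n" using P M by auto
      have "(\<Sum>l<n. M $$ (\<pi> i, \<pi> l) * (if \<pi> l = j then 1 else 0))
          = (\<Sum>l<n. M $$ (\<pi> i, l) * (if l = j then 1 else 0))"
        by (rule sum.reindex_bij_betw[OF \<pi>])
      also have "\<dots> = M $$ (\<pi> i, j)" using ij by (simp add: if_distrib cong: if_cong)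
      also have "\<dots> = (\<Sum>l<n. P $$ (i, l) * M $$ (l, j))"
        using ij \<pi>n[OF ij(1)] by (simp add: P_def if_distrib if_distribR cong: if_cong)
      finally show "(mat n n (\<lambda>(i, j). M $$ (\<pi> i, \<pi> j)) * P) $$ (i, j) = (P * M) $$ (i, j)"
        using ij M by (simp add: index_mult_mat_sum[OF P M] index_mult_mat_sum[OF _ P, where m = n] del: index_mult_mat)
          (simp add: P_def)
    qed (use P M in auto)
  qed auto
qed

section \<open>Conjugation invariance of values and of their differences\<close>

lemma word_eval_conj:
  fixes a :: "nat \<Rightarrow> 'a::comm_ring_1 mat"
  assumes a: "\<forall>i. a i \<in> carrier_mat n n"
    and P: "P \<in> carrier_mat n n" "Q \<in> carrier_mat n n" "P * Q = 1\<^sub>m n" "Q * P = 1\<^sub>m n"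
  shows "word_eval n (\<lambda>i. P * a i * Q) w = P * word_eval n a w * Q"
proof (induction w)
  case Nil
  show ?case using P by (simp add: word_eval_def)
next
  case (Cons i w)
  note W = word_eval_carrier[OF a, of w]
  \<comment> \<open>The inner factor \<open>Q * P\<close> is the identity, so the conjugations of
    successive letters telescope.\<close>
  have "P * a i * Q * (P * word_eval n a w * Q) = P * a i * (Q * P) * (word_eval n a w * Q)"
    using a[rule_format, of i] P(1,2) W by (simp add: assoc_mult_mat[of _ n n _ n _ n])
  also have "\<dots> = P * (a i * word_eval n a w) * Q"
    using a[rule_format, of i] P W by (simp add: assoc_mult_mat[of _ n n _ n _ n])
  finally show ?case using Cons by (simp add: word_eval_def)
qed

lemma free_eval_conj:
  fixes a :: "nat \<Rightarrow> 'a::comm_ring_1 mat"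
  assumes a: "\<forall>i. a i \<in> carrier_mat n n"
    and P: "P \<in> carrier_mat n n" "Q \<in> carrier_mat n n" "P * Q = 1\<^sub>m n" "Q * P = 1\<^sub>m n"
  shows "free_eval n (\<lambda>i. P * a i * Q) f = P * free_eval n a f * Q"
proof -
  have a': "\<forall>i. P * a i * Q \<in> carrier_mat n n" using a P by auto
  show ?thesis
  proof (induction f rule: poly_mapping_single_add_induct)
    case 1
    show ?case using P by (simp add: free_eval_zero[OF a] free_eval_zero[OF a'])
  next
    case (2 w c g)
    note W = word_eval_carrier[OF a, of w] and G = free_eval_carrier[OF a, of g]
    show ?case
      using P(1,2) W G
      by (simp add: free_eval_add[OF a] free_eval_add[OF a'] free_eval_single[OF a]
          free_eval_single[OF a'] word_eval_conj[OF a P] 2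
          mult_add_distrib_mat[of _ n n _ n] add_mult_distrib_mat[of _ n n _ _ n]
          mult_smult_distrib[of _ n n _ n] mult_smult_assoc_mat[of _ n n _ n])
  qed
qed

lemma poly_image_carrier: "X \<in> poly_image n f \<Longrightarrow> X \<in> carrier_mat n n"
  by (auto simp: poly_image_def)

lemma poly_image_similar:
  assumes X: "X \<in> poly_image n f" and sim: "similar_mat Y X"
  shows "Y \<in> poly_image n f"
proof -
  obtain a where a: "\<forall>i. a i \<in> carrier_mat n n" "X = free_eval n a f"
    using X by (auto simp: poly_image_def)
  obtain m P Q where PQ: "{Y, X, P, Q} \<subseteq> carrier_mat m m" "P * Q = 1\<^sub>m m" "Q * P = 1\<^sub>m m" "Y = P * X * Q"
    using similar_matD[OF sim] by blast
  have "m = n" using PQ(1) poly_image_carrier[OF X] by auto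
  then have "Y = free_eval n (\<lambda>i. P * a i * Q) f"
    using PQ a by (subst free_eval_conj[OF a(1)]) auto
  moreover have "\<forall>i. P * a i * Q \<in> carrier_mat n n"
    using a PQ \<open>m = n\<close> by auto
  ultimately show ?thesis by (auto simp: poly_image_def)
qed

lemma poly_image_diff_carrier: "X \<in> poly_image_diff n f \<Longrightarrow> X \<in> carrier_mat n n"
  by (auto simp: poly_image_diff_def dest!: poly_image_carrier intro: minus_carrier_mat)

lemma poly_image_diff_similar:
  assumes D: "D \<in> poly_image_diff n f" and sim: "similar_mat E D"
  shows "E \<in> poly_image_diff n f"
proof -
  obtain t t' where t: "D = t - t'" "t \<in> poly_image n f" "t' \<in> poly_image n f"
    using D by (auto simp: poly_image_diff_def)
  obtain m P Q where PQ: "{E, D, P, Q} \<subseteq> carrier_mat m m" "P * Q = 1\<^sub>m m" "Q * P = 1\<^sub>m m" "E = P * D * Q"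
    using similar_matD[OF sim] by blast
  have [simp]: "m = n" using PQ(1) poly_image_diff_carrier[OF D] by auto
  have c: "t \<in> carrier_mat n n" "t' \<in> carrier_mat n n" using t by (auto simp: poly_image_carrier)
  have "P * s * Q \<in> poly_image n f" if "s \<in> poly_image n f" for s
    by (rule poly_image_similar[OF that], rule similar_matI[of _ _ P Q n])
      (use PQ poly_image_carrier[OF that] in auto)
  moreover have "E = P * t * Q - P * t' * Q"
    using PQ c mult_carrier_mat[of P n n t n] mult_carrier_mat[of P n n t' n]
    by (simp add: t(1) mult_minus_distrib_mat[of _ n n _ n] minus_mult_distrib_mat[of _ n n _ _ n])
  ultimately show ?thesis using t by (auto simp: poly_image_diff_def)
qed

text \<open>\<open>1 + v\<close> and \<open>1 - v\<close> are mutually inverse because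
  \<open>v * v = 0\<close>. In the difference of the two conjugates of \<open>X\<close> the terms
  \<open>X\<close> and \<open>v * X * v\<close> cancel and the linear terms double, which the factor
  1/2 in \<open>v\<close> compensates.\<close>

lemma commutator_in_poly_image_diff:
  fixes X u :: "'a::field_char_0 mat"
  assumes X: "X \<in> poly_image n f" and u: "u \<in> carrier_mat n n" and u2: "u * u = 0\<^sub>m n n"
  shows "u * X - X * u \<in> poly_image_diff n f"
proof -
  define v where "v = (1 / 2) \<cdot>\<^sub>m u"
  have v: "v \<in> carrier_mat n n" using u by (simp add: v_def)
  have v2: "v * v = 0\<^sub>m n n"
    using u by (auto simp: v_def mult_smult_distrib[of _ n n _ n] mult_smult_assoc_mat[of _ n n _ n] u2)
  have Xc: "X \<in> carrier_mat n n" by (rule poly_image_carrier[OF X])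
  have inv: "(1\<^sub>m n + v) * (1\<^sub>m n - v) = 1\<^sub>m n" "(1\<^sub>m n - v) * (1\<^sub>m n + v) = 1\<^sub>m n"
    using v by (auto simp: add_mult_distrib_mat[of _ n n _ _ n] mult_minus_distrib_mat[of _ n n _ n]
        mult_add_distrib_mat[of _ n n _ n] minus_mult_distrib_mat[of _ n n _ _ n] v2)
  have c: "1\<^sub>m n + v \<in> carrier_mat n n" "1\<^sub>m n - v \<in> carrier_mat n n" using v by auto
  have "(1\<^sub>m n + v) * X * (1\<^sub>m n - v) \<in> poly_image n f"
    by (rule poly_image_similar[OF X], rule similar_matI[of _ _ "1\<^sub>m n + v" "1\<^sub>m n - v" n])
      (use c inv Xc in auto)
  moreover have "(1\<^sub>m n - v) * X * (1\<^sub>m n + v) \<in> poly_image n f"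
    by (rule poly_image_similar[OF X], rule similar_matI[of _ _ "1\<^sub>m n - v" "1\<^sub>m n + v" n])
      (use c inv Xc in auto)
  moreover have "u * X - X * u
      = (1\<^sub>m n + v) * X * (1\<^sub>m n - v) - (1\<^sub>m n - v) * X * (1\<^sub>m n + v)"
  proof -
    have vX: "v * X \<in> carrier_mat n n" "X * v \<in> carrier_mat n n" "v * X * v \<in> carrier_mat n n"
      using v Xc by auto
    have 1: "(1\<^sub>m n + v) * X * (1\<^sub>m n - v) = (X + v * X) - (X * v + v * X * v)"
    proof -
      have d: "X + v * X \<in> carrier_mat n n" using Xc vX by auto
      have a: "(1\<^sub>m n + v) * X = X + v * X"
        using v Xc by (subst add_mult_distrib_mat[of _ n n _ _ n]) auto
      have b: "(X + v * X) * (1\<^sub>m n - v) = (X + v * X) * 1\<^sub>m n - (X + v * X) * v"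
        by (rule mult_minus_distrib_mat[OF d _ v]) auto
      have c: "(X + v * X) * v = X * v + v * X * v"
        by (rule add_mult_distrib_mat[OF Xc vX(1) v])
      show ?thesis by (simp only: a b c right_mult_one_mat[OF d])
    qed
    have 2: "(1\<^sub>m n - v) * X * (1\<^sub>m n + v) = (X - v * X) + (X * v - v * X * v)"
    proof -
      have d: "X - v * X \<in> carrier_mat n n" by (rule minus_carrier_mat[OF vX(1)])
      have a: "(1\<^sub>m n - v) * X = X - v * X"
        using v Xc by (subst minus_mult_distrib_mat[of _ n n _ _ n]) auto
      have b: "(X - v * X) * (1\<^sub>m n + v) = (X - v * X) * 1\<^sub>m n + (X - v * X) * v"
        by (rule mult_add_distrib_mat[OF d _ v]) auto
      have c: "(X - v * X) * v = X * v - v * X * v"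
        by (rule minus_mult_distrib_mat[OF Xc vX(1) v])
      show ?thesis by (simp only: a b c right_mult_one_mat[OF d])
    qed
    have uv: "u * X = 2 \<cdot>\<^sub>m (v * X)" "X * u = 2 \<cdot>\<^sub>m (X * v)"
      using u Xc by (auto simp: v_def mult_smult_distrib[of _ n n _ n] mult_smult_assoc_mat[of _ n n _ n])
    have "2 \<cdot>\<^sub>m A - 2 \<cdot>\<^sub>m B = (X + A) - (B + C) - ((X - A) + (B - C))"
      if "A \<in> carrier_mat n n" "B \<in> carrier_mat n n" "C \<in> carrier_mat n n" for A B C
    proof (rule eq_matI)
      fix i j assume "i < dim_row (X + A - (B + C) - (X - A + (B - C)))" "j < dim_col (X + A - (B + C) - (X - A + (B - C)))"
      then show "(2 \<cdot>\<^sub>m A - 2 \<cdot>\<^sub>m B) $$ (i, j) = (X + A - (B + C) - (X - A + (B - C))) $$ (i, j)"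
        using Xc that by simp
    qed (use Xc that in simp_all)
    from this[OF vX] show ?thesis unfolding 1 2 uv .
  qed
  ultimately show ?thesis by (auto simp: poly_image_diff_def)
qed

section \<open>Square-zero matrices of every small rank\<close>

definition offset_unit_mat :: "nat \<Rightarrow> nat \<Rightarrow> nat \<Rightarrow> 'a::{zero,one} mat" where
  "offset_unit_mat n h r = mat n n (\<lambda>(i, j). if i < r \<and> j = h + i then 1 else 0)"

text \<open>For \<open>r \<le> h\<close> and \<open>h + h \<le> n\<close>,
  \<open>offset_unit_mat n h r\<close> represents the square-zero matrices of rank \<open>r\<close>.
  With \<open>u\<close> supported at the same positions \<open>(i, h + i)\<close>, the commutator
  \<open>W\<close> has ones there, and its row \<open>i < r\<close> starts at column
  \<open>h + i\<close>. Replacing rows \<open>h, ..., h + r - 1\<close> of the identity by these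
  rows of \<open>W\<close> gives a unitriangular \<open>Q\<close> with
  \<open>?C * Q = W = Q * W\<close>.\<close>

lemma offset_unit_mat_in_poly_image_diff:
  fixes B :: "'a::field_char_0 mat"
  assumes B: "B \<in> poly_image n f" and tri: "upper_triangular B"
    and hn: "h + h \<le> n" and rh: "r \<le> h"
    and dist: "\<And>i. i < r \<Longrightarrow> B $$ (i, i) \<noteq> B $$ (h + i, h + i)"
  shows "offset_unit_mat n h r \<in> poly_image_diff n f"
proof -
  \<comment> \<open>The weights normalise the entry of the commutator at \<open>(i, h + i)\<close>,
    which is \<open>b i\<close> times a difference of two diagonal entries of
    \<open>B\<close>.\<close>
  define b where "b i = 1 / (B $$ (h + i, h + i) - B $$ (i, i))" for i
  define u :: "'a mat" where "u = mat n n (\<lambda>(i, j). if i < r \<and> j = h + i then b i else 0)"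
  have u: "u \<in> carrier_mat n n" by (simp add: u_def)
  have Bc: "B \<in> carrier_mat n n" by (rule poly_image_carrier[OF B])
  have B0: "B $$ (i, j) = 0" if "j < i" "i < n" for i j
    using tri Bc that by auto
  have u2: "u * u = 0\<^sub>m n n"
  proof (rule eq_matI)
    fix i j assume "i < dim_row (0\<^sub>m n n :: 'a mat)" "j < dim_col (0\<^sub>m n n :: 'a mat)"
    then have ij: "i < n" "j < n" by auto
    \<comment> \<open>Rows of the support lie below \<open>r\<close>, columns from
      \<open>h \<ge> r\<close> on, so no two nonzero entries can be chained.\<close>
    have "u $$ (i, l) * u $$ (l, j) = 0" if "l < n" for l
      using that ij rh by (auto simp: u_def)
    then show "(u * u) $$ (i, j) = 0\<^sub>m n n $$ (i, j)"
      unfolding index_mult_mat_sum[OF u u ij] using ij by (simp add: sum.neutral)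
  qed (use u in auto)
  define W where "W = u * B - B * u"
  have W: "W \<in> carrier_mat n n" using u Bc by (auto simp: W_def)
  have uB: "(u * B) $$ (i, j) = (if i < r then b i * B $$ (h + i, j) else 0)" if "i < n" "j < n" for i j
  proof -
    have "(u * B) $$ (i, j) = (\<Sum>l<n. if l = h + i then (if i < r then b i * B $$ (h + i, j) else 0) else 0)"
      unfolding index_mult_mat_sum[OF u Bc that] by (rule sum.cong) (use that in \<open>auto simp: u_def\<close>)
    then show ?thesis using rh hn by auto
  qed
  have Bu: "(B * u) $$ (i, j) = (if h \<le> j \<and> j < h + r then B $$ (i, j - h) * b (j - h) else 0)"
    if "i < n" "j < n" for i j
  proof -
    have "(B * u) $$ (i, j) = (\<Sum>l<n. if l = j - h then (if h \<le> j \<and> j < h + r then B $$ (i, j - h) * b (j - h) else 0) else 0)"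
      unfolding index_mult_mat_sum[OF Bc u that] by (rule sum.cong) (use that in \<open>auto simp: u_def\<close>)
    then show ?thesis using that by auto
  qed
  have Wij: "W $$ (i, j) = (u * B) $$ (i, j) - (B * u) $$ (i, j)" if "i < n" "j < n" for i j
    using that u Bc by (simp add: W_def)
  have W_low: "W $$ (i, j) = 0" if "r \<le> i" "i < n" "j < n" for i j
    using that B0[of "j - h" i] by (auto simp: Wij uB Bu)
  have W_left: "W $$ (i, j) = 0" if "i < r" "j < h + i" "i < n" "j < n" for i j
    using that B0[of "j - h" i] B0[of j "h + i"] rh hn by (auto simp: Wij uB Bu)
  have W_diag: "W $$ (i, h + i) = 1" if "i < r" for i
    using that rh hn dist[OF that] by (simp add: Wij uB Bu b_def divide_simps)
  define Q :: "'a mat" where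
    "Q = mat n n (\<lambda>(i, j). if h \<le> i \<and> i < h + r then W $$ (i - h, j) else if i = j then 1 else 0)"
  have Q: "Q \<in> carrier_mat n n" by (simp add: Q_def)
  have "upper_triangular Q"
  proof (rule upper_triangularI)
    fix i j assume "j < i" "i < dim_row Q"
    then show "Q $$ (i, j) = 0" using W_left[of "i - h" j] hn by (auto simp: Q_def)
  qed
  then have "det Q = prod_list (diag_mat Q)" by (rule det_upper_triangular[OF _ Q])
  also have "diag_mat Q = map (\<lambda>i. 1) [0..<n]"
  proof -
    have "Q $$ (i, i) = 1" if "i < n" for i
      using that W_diag[of "i - h"] by (auto simp: Q_def)
    then show ?thesis using Q by (auto simp: diag_mat_def)
  qed
  also have "prod_list \<dots> = 1" by (simp add: map_replicate_const)
  finally have detQ: "det Q \<noteq> 0" by simp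
  let ?C = "offset_unit_mat n h r :: 'a mat"
  have C: "?C \<in> carrier_mat n n" by (simp add: offset_unit_mat_def)
  have CQ: "?C * Q = W"
  proof (rule eq_matI)
    fix i j assume "i < dim_row W" "j < dim_col W"
    then have ij: "i < n" "j < n" using W by auto
    have "(?C * Q) $$ (i, j) = (\<Sum>l<n. if l = h + i then (if i < r then Q $$ (h + i, j) else 0) else 0)"
      unfolding index_mult_mat_sum[OF C Q ij] by (rule sum.cong) (use ij in \<open>auto simp: offset_unit_mat_def\<close>)
    also have "\<dots> = W $$ (i, j)"
      using ij rh hn W_low by (auto simp: Q_def)
    finally show "(?C * Q) $$ (i, j) = W $$ (i, j)" .
  qed (use C Q W in auto)
  have QW: "Q * W = W"
  proof (rule eq_matI)
    fix i j assume "i < dim_row W" "j < dim_col W"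
    then have ij: "i < n" "j < n" using W by auto
    show "(Q * W) $$ (i, j) = W $$ (i, j)"
    proof (cases "h \<le> i \<and> i < h + r")
      case True
      have "Q $$ (i, l) * W $$ (l, j) = 0" if "l < n" for l
        using True ij that W_left[of "i - h" l] W_low[of l j] rh hn
        by (cases "l < r") (auto simp: Q_def)
      then show ?thesis
        using True ij rh W_low[of i j] unfolding index_mult_mat_sum[OF Q W ij] by (simp add: sum.neutral)
    next
      case False
      have "(Q * W) $$ (i, j) = (\<Sum>l<n. if l = i then W $$ (i, j) else 0)"
        unfolding index_mult_mat_sum[OF Q W ij] by (rule sum.cong) (use ij False in \<open>auto simp: Q_def\<close>)
      then show ?thesis using ij by auto
    qed
  qed (use Q W in auto)
  have "similar_mat ?C W"
    by (rule similar_mat_intertwine[OF C W Q detQ]) (simp add: CQ QW)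
  moreover have "W \<in> poly_image_diff n f"
    unfolding W_def by (rule commutator_in_poly_image_diff[OF B u u2])
  ultimately show ?thesis using poly_image_diff_similar by blast
qed

section \<open>Traceless matrices as sums of four matrices of square zero\<close>

text \<open>Nilpotent Jordan matrices have this form; an index missing from \<open>I\<close> ends a
  block.\<close>

definition superdiag_mat :: "nat \<Rightarrow> nat set \<Rightarrow> 'a::{zero,one} mat" where
  "superdiag_mat n I = mat n n (\<lambda>(i, j). if i \<in> I \<and> j = Suc i then 1 else 0)"

text \<open>The pairs \<open>{i, Suc i}\<close> with \<open>i \<in> I\<close> are disjoint because
  \<open>I\<close> has no consecutive elements. Hence \<open>2 * card I \<le> n\<close>, and an
  enumeration \<open>g\<close> of \<open>I\<close> extends to a permutation that sends
  \<open>i\<close> to \<open>g i\<close> and \<open>Suc i\<close> to \<open>h + g i\<close>.\<close>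

lemma superdiag_mat_similar_offset_unit_mat:
  assumes I: "I \<subseteq> {i. Suc i < n}" and gap: "\<And>i. i \<in> I \<Longrightarrow> Suc i \<notin> I"
  shows "card I \<le> n div 2"
    and "similar_mat (superdiag_mat n I :: 'a::field mat) (offset_unit_mat n (n div 2) (card I))"
proof -
  define h r where "h = n div 2" and "r = card I"
  have "finite {i. Suc i < n}" by (rule finite_subset[of _ "{..<n}"]) auto
  then have fI: "finite I" using I finite_subset by blast
  define A where "A = I \<union> Suc ` I"
  have A: "A \<subseteq> {..<n}" using I by (auto simp: A_def)
  have "card A = r + card (Suc ` I)" unfolding A_def r_def
    by (rule card_Un_disjoint) (use fI gap in auto)
  then have cA: "card A = 2 * r" by (simp add: card_image r_def)
  have "card A \<le> n" using card_mono[OF _ A] by simp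
  then have rh: "r \<le> h" using cA by (simp add: h_def)
  then show "card I \<le> n div 2" by (simp add: h_def r_def)
  obtain g where g: "bij_betw g I {0..<r}"
    using ex_bij_betw_finite_nat[OF fI] by (auto simp: r_def)
  have gr: "g i < r" if "i \<in> I" for i using bij_betwE[OF g] that by auto
  have ginj: "g i = g j \<longleftrightarrow> i = j" if "i \<in> I" "j \<in> I" for i j
    using g that by (auto simp: bij_betw_def inj_on_def)
  define p where "p i = (if i \<in> I then g i else h + g (i - 1))" for i
  have p1: "p i = g i" if "i \<in> I" for i using that by (simp add: p_def)
  have p2: "p (Suc i) = h + g i" if "i \<in> I" for i using that gap[OF that] by (simp add: p_def)
  have pinj: "inj_on p A"
  proof (rule inj_onI)
    fix a b assume "a \<in> A" "b \<in> A" and eq: "p a = p b"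
    then consider "a \<in> I" "b \<in> I" | i where "a \<in> I" "i \<in> I" "b = Suc i"
      | i where "i \<in> I" "a = Suc i" "b \<in> I" | i j where "i \<in> I" "a = Suc i" "j \<in> I" "b = Suc j"
      unfolding A_def by blast
    then show "a = b"
    proof cases
      case 1 then show ?thesis using eq ginj by (simp add: p1)
    next
      case 2 then show ?thesis using eq gr[of a] rh by (simp add: p1 p2)
    next
      case 3 then show ?thesis using eq gr[of b] rh by (simp add: p1 p2)
    next
      case 4 then show ?thesis using eq ginj by (simp add: p2)
    qed
  qed
  have h2: "2 * h \<le> n" by (simp add: h_def)
  have pA: "p ` A \<subseteq> {..<n}"
  proof -
    have "p a < n" if "a \<in> I" for a
      using gr[OF that] rh h2 by (simp add: p1[OF that])
    moreover have "p (Suc i) < n" if "i \<in> I" for i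
      using gr[OF that] rh h2 by (simp add: p2[OF that])
    ultimately show ?thesis by (auto simp: A_def)
  qed
  have "card ({..<n} - A) = card ({..<n} - p ` A)"
    using A pA card_image[OF pinj] finite_subset[OF A] by (simp add: card_Diff_subset)
  then obtain k where k: "bij_betw k ({..<n} - A) ({..<n} - p ` A)"
    using finite_same_card_bij[of "{..<n} - A" "{..<n} - p ` A"] by auto
  define \<pi> where "\<pi> i = (if i \<in> A then p i else k i)" for i
  have 1: "bij_betw \<pi> A (p ` A)"
    using pinj by (auto simp: bij_betw_def \<pi>_def inj_on_def)
  have 2: "bij_betw \<pi> ({..<n} - A) ({..<n} - p ` A)"
    using k by (subst bij_betw_cong[of _ _ k]) (auto simp: \<pi>_def)
  have \<pi>: "bij_betw \<pi> {..<n} {..<n}"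
    using bij_betw_combine[OF 1 2] A pA by (simp add: Un_absorb1)
  have \<pi>inj: "\<pi> i = \<pi> j \<longleftrightarrow> i = j" if "i < n" "j < n" for i j
    using \<pi> that by (auto simp: bij_betw_def inj_on_def)
  have \<pi>1: "\<pi> i = g i" "\<pi> (Suc i) = h + g i" if "i \<in> I" for i
    using that by (auto simp: \<pi>_def A_def p1 p2)
  have entry: "(\<pi> i < r \<and> \<pi> j = h + \<pi> i) \<longleftrightarrow> (i \<in> I \<and> j = Suc i)" if ij: "i < n" "j < n" for i j
  proof
    assume L: "\<pi> i < r \<and> \<pi> j = h + \<pi> i"
    then obtain i0 where i0: "i0 \<in> I" "g i0 = \<pi> i"
      using g by (metis atLeast0LessThan bij_betw_imp_surj_on imageE lessThan_iff)
    have i0n: "Suc i0 < n" using I i0(1) by auto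
    have "\<pi> i0 = \<pi> i" using \<pi>1(1)[OF i0(1)] i0(2) by simp
    then have "i0 = i" using \<pi>inj[of i0 i] ij i0n by simp
    moreover have "\<pi> (Suc i0) = \<pi> j" using L i0 \<pi>1[OF i0(1)] by simp
    then have "Suc i0 = j" using \<pi>inj[of "Suc i0" j] i0n ij by simp
    ultimately show "i \<in> I \<and> j = Suc i" using i0 by simp
  next
    assume "i \<in> I \<and> j = Suc i"
    then show "\<pi> i < r \<and> \<pi> j = h + \<pi> i" using \<pi>1 gr by auto
  qed
  let ?C = "offset_unit_mat n h r :: 'a mat"
  have C: "?C \<in> carrier_mat n n" by (simp add: offset_unit_mat_def)
  have \<pi>n: "\<pi> i < n" if "i < n" for i using \<pi> that by (auto simp: bij_betw_def)
  have "mat n n (\<lambda>(i, j). ?C $$ (\<pi> i, \<pi> j)) = superdiag_mat n I"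
    by (rule eq_matI) (simp_all add: offset_unit_mat_def superdiag_mat_def \<pi>n entry)
  then show "similar_mat (superdiag_mat n I :: 'a mat) (offset_unit_mat n (n div 2) (card I))"
    using similar_mat_permute[OF C \<pi>] by (simp add: h_def r_def)
qed

section \<open>Nilpotent matrices as sums of two square-zero matrices\<close>

lemma jordan_matrix_index:
  assumes "i < sum_list (map fst n_as)" "j < sum_list (map fst n_as)"
    and "\<And>k a. (k, a) \<in> set n_as \<Longrightarrow> k \<noteq> 0 \<Longrightarrow> a = (0::'a::{zero,one})"
  shows "jordan_matrix n_as $$ (i, j) = 0 \<or> (j = Suc i \<and> jordan_matrix n_as $$ (i, j) = (1::'a))"
  using assms
proof (induction n_as arbitrary: i j)
  case (Cons na n_as)
  obtain k a where na: "na = (k, a)" by force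
  have IH: "jordan_matrix n_as $$ (i, j) = 0 \<or> (j = Suc i \<and> jordan_matrix n_as $$ (i, j) = 1)"
    if "i < sum_list (map fst n_as)" "j < sum_list (map fst n_as)" for i j
    by (rule Cons.IH[OF that]) (use Cons.prems(3) in auto)
  have a: "k \<noteq> 0 \<Longrightarrow> a = 0" using Cons.prems(3)[of k a] na by simp
  have ij: "i < k + sum_list (map fst n_as)" "j < k + sum_list (map fst n_as)"
    using Cons.prems(1,2) by (auto simp: na)
  consider "i < k" "j < k" | "i < k" "\<not> j < k" | "\<not> i < k" "j < k" | "\<not> i < k" "\<not> j < k" by blast
  then show ?case
  proof cases
    case 4
    have "j = Suc i" if "j - k = Suc (i - k)" using that 4 by arith
    then show ?thesis using 4 ij IH[of "i - k" "j - k"] by (auto simp: na jordan_matrix_Cons)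
  qed (use ij a in \<open>auto simp: na jordan_matrix_Cons\<close>)
qed simp

text \<open>The conjugation that carries \<open>A + B\<close> to \<open>X\<close> is applied to each
  summand. Decompositions within a similarity-closed set thus pass to similar matrices.\<close>

lemma similar_mat_add:
  assumes sim: "similar_mat X (A + B)" and c: "A \<in> carrier_mat n n" "B \<in> carrier_mat n n"
  obtains A' B' where "similar_mat A' A" "similar_mat B' B" "X = A' + B'"
proof -
  obtain m P Q where PQ: "{X, A + B, P, Q} \<subseteq> carrier_mat m m" "P * Q = 1\<^sub>m m" "Q * P = 1\<^sub>m m" "X = P * (A + B) * Q"
    using similar_matD[OF sim] by blast
  have [simp]: "m = n" using PQ(1) c by auto
  have PA: "P * A \<in> carrier_mat n n" "P * B \<in> carrier_mat n n" using PQ c by auto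
  show ?thesis
  proof
    show "similar_mat (P * A * Q) A" "similar_mat (P * B * Q) B"
      by (rule similar_matI[of _ _ P Q n]; use PQ c in auto)+
    show "X = P * A * Q + P * B * Q"
      using PQ c PA by (simp add: mult_add_distrib_mat[of _ n n _ n] add_mult_distrib_mat[of _ n n _ _ n])
  qed
qed

text \<open>The zero diagonal makes the characteristic polynomial the \<open>n\<close>-th power of
  the indeterminate, so all Jordan blocks have eigenvalue 0. Triangularity supplies the Jordan form
  over any field.\<close>

lemma strictly_upper_similar_superdiag_mat:
  fixes U :: "'a::field mat"
  assumes U: "U \<in> carrier_mat n n" and U0: "\<And>i j. i < n \<Longrightarrow> j \<le> i \<Longrightarrow> U $$ (i, j) = 0"
  obtains I where "I \<subseteq> {i. Suc i < n}" "similar_mat U (superdiag_mat n I)"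
proof -
  have ut: "upper_triangular U" using U U0 by auto
  obtain n_as where jnf: "jordan_nf U n_as" using triangular_to_jnf_vector[OF U ut] by blast
  let ?J = "jordan_matrix n_as"
  have sim: "similar_mat U ?J" using jnf by (simp add: jordan_nf_def)
  have J: "?J \<in> carrier_mat n n" using similar_matD[OF sim] U by auto
  then have len: "sum_list (map fst n_as) = n" by auto
  have "map (\<lambda>a. [:- a, 1:]) (diag_mat U) = replicate n [:0, 1:]"
    using U U0 by (intro nth_equalityI) (auto simp: diag_mat_def)
  then have cp: "char_poly U = [:0, 1:] ^ n"
    using char_poly_upper_triangular[OF U ut] by simp
  have ev: "a = 0" if "(k, a) \<in> set n_as" "k \<noteq> 0" for k a
  proof -
    have "poly (char_poly U) a = 0"
      unfolding jordan_nf_char_poly[OF jnf] poly_prod_list using that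
      by (force simp: prod_list_zero_iff)
    then show "a = 0" by (simp add: cp)
  qed
  define I where "I = {i. Suc i < n \<and> ?J $$ (i, Suc i) = 1}"
  have "?J = superdiag_mat n I"
  proof (rule eq_matI)
    fix i j assume "i < dim_row (superdiag_mat n I :: 'a mat)" "j < dim_col (superdiag_mat n I :: 'a mat)"
    then have "i < n" "j < n" by (auto simp: superdiag_mat_def)
    moreover have "?J $$ (i, j) = 0 \<or> (j = Suc i \<and> ?J $$ (i, j) = 1)"
      by (rule jordan_matrix_index[OF _ _ ev]) (use calculation len in auto)
    ultimately show "?J $$ (i, j) = superdiag_mat n I $$ (i, j)"
      by (auto simp: superdiag_mat_def I_def)
  qed (use len in \<open>auto simp: superdiag_mat_def\<close>)
  then show ?thesis using that[of I] sim by (auto simp: I_def)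
qed

text \<open>\<open>\<D>\<close> abstracts f(A) - f(A): a similarity-closed set containing the
  square-zero representatives. Splitting the superdiagonal by parity leaves no consecutive positions
  in either part.\<close>

lemma strictly_upper_sum_two:
  fixes U :: "'a::field mat"
  assumes C: "\<And>r. r \<le> n div 2 \<Longrightarrow> offset_unit_mat n (n div 2) r \<in> \<D>"
    and sim: "\<And>D E. D \<in> \<D> \<Longrightarrow> similar_mat E D \<Longrightarrow> E \<in> \<D>"
    and U: "U \<in> carrier_mat n n" and U0: "\<And>i j. i < n \<Longrightarrow> j \<le> i \<Longrightarrow> U $$ (i, j) = 0"
  shows "\<exists>D\<in>\<D>. \<exists>E\<in>\<D>. U = D + E"
proof -
  obtain I where I: "I \<subseteq> {i. Suc i < n}" "similar_mat U (superdiag_mat n I)"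
    by (rule strictly_upper_similar_superdiag_mat[OF U U0])
  have D: "superdiag_mat n J \<in> \<D>" if "J \<subseteq> I" "\<And>i. i \<in> J \<Longrightarrow> Suc i \<notin> J" for J
    using superdiag_mat_similar_offset_unit_mat[of J n] that I(1) C sim by blast
  have "superdiag_mat n I = (superdiag_mat n (I \<inter> {i. even i}) + superdiag_mat n (I \<inter> {i. odd i}) :: 'a mat)"
    by (rule eq_matI) (auto simp: superdiag_mat_def)
  with I(2) have "similar_mat U (superdiag_mat n (I \<inter> {i. even i}) + superdiag_mat n (I \<inter> {i. odd i}))"
    by simp
  then obtain A B where "similar_mat A (superdiag_mat n (I \<inter> {i. even i}))"
    "similar_mat B (superdiag_mat n (I \<inter> {i. odd i}))" "U = A + B"
    by (rule similar_mat_add[of _ _ _ n]) (auto simp: superdiag_mat_def)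
  moreover have "superdiag_mat n (I \<inter> {i. even i}) \<in> \<D>" "superdiag_mat n (I \<inter> {i. odd i}) \<in> \<D>"
    by (rule D; auto)+
  ultimately show ?thesis using sim by blast
qed

text \<open>Conjugation by \<open>P\<close>, the identity with an extra \<open>x\<close> at
  \<open>(i, j)\<close>: adding \<open>x\<close> times row \<open>j\<close> to row \<open>i\<close>
  gives \<open>R\<close>, then \<open>x\<close> times column \<open>i\<close> is subtracted from
  column \<open>j\<close>. On the diagonal this only moves \<open>x * T $$ (j, i)\<close> from
  position \<open>j\<close> to position \<open>i\<close>.\<close>

lemma similar_mat_transvection:
  fixes T :: "'a::field mat"
  assumes T: "T \<in> carrier_mat n n" and ij: "i < n" "j < n" "i \<noteq> j"
  obtains T' where "similar_mat T' T" "T' \<in> carrier_mat n n"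
    "\<And>k. k < n \<Longrightarrow> k \<noteq> i \<Longrightarrow> k \<noteq> j \<Longrightarrow> T' $$ (k, k) = T $$ (k, k)"
    "T' $$ (i, i) = T $$ (i, i) + x * T $$ (j, i)" "T' $$ (j, j) = T $$ (j, j) - x * T $$ (j, i)"
    "T' $$ (i, j) = T $$ (i, j) + x * (T $$ (j, j) - T $$ (i, i)) - x\<^sup>2 * T $$ (j, i)"
proof -
  define R where "R = (\<lambda>a b. T $$ (a, b) + (if a = i then x * T $$ (j, b) else 0))"
  define T' where "T' = mat n n (\<lambda>(a, b). R a b - (if b = j then x * R a i else 0))"
  define P :: "'a mat" where
    "P = mat n n (\<lambda>(a, b). (if a = b then 1 else 0) + (if a = i \<and> b = j then x else 0))"
  have P: "P \<in> carrier_mat n n" and T': "T' \<in> carrier_mat n n" by (auto simp: P_def T'_def)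
  have "similar_mat T' T"
  proof (rule similar_mat_intertwine[OF T' T P])
    show "det P \<noteq> 0"
    proof (rule det_nonzeroI[OF P])
      fix y assume y: "\<And>a. a < n \<Longrightarrow> (\<Sum>b<n. P $$ (a, b) * y b) = 0"
      have Py: "(\<Sum>b<n. P $$ (a, b) * y b) = y a + (if a = i then x * y j else 0)" if "a < n" for a
      proof -
        have "(\<Sum>b<n. P $$ (a, b) * y b) = (\<Sum>b<n. (if b = a then y a else 0) + (if b = j then (if a = i then x * y j else 0) else 0))"
          by (rule sum.cong) (use that ij in \<open>auto simp: P_def\<close>)
        then show ?thesis using that ij by (simp add: sum.distrib)
      qed
      have "y j = 0" using y[OF ij(2)] Py[OF ij(2)] ij by simp
      then have "y a = 0" if "a < n" for a using y[OF that] Py[OF that] by (simp split: if_splits)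
      then show "\<forall>a<n. y a = 0" by blast
    qed
    show "T' * P = P * T"
    proof (rule eq_matI)
      fix a b assume "a < dim_row (P * T)" "b < dim_col (P * T)"
      then have ab: "a < n" "b < n" using P T by auto
      have "(T' * P) $$ (a, b) = (\<Sum>l<n. (if l = b then T' $$ (a, b) else 0) + (if l = i then (if b = j then x * T' $$ (a, i) else 0) else 0))"
        unfolding index_mult_mat_sum[OF T' P ab] by (rule sum.cong) (use ab ij in \<open>auto simp: P_def\<close>)
      also have "\<dots> = R a b"
        using ab ij by (simp add: sum.distrib T'_def)
      also have "R a b = (\<Sum>l<n. (if l = a then T $$ (a, b) else 0) + (if l = j then (if a = i then x * T $$ (j, b) else 0) else 0))"
        using ab ij by (simp add: sum.distrib R_def)
      also have "\<dots> = (P * T) $$ (a, b)"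
        unfolding index_mult_mat_sum[OF P T ab] by (rule sum.cong) (use ab ij in \<open>auto simp: P_def\<close>)
      finally show "(T' * P) $$ (a, b) = (P * T) $$ (a, b)" .
    qed (use P T T' in auto)
  qed
  then show ?thesis
    by (rule that[OF _ T']) (use ij in \<open>auto simp: T'_def R_def algebra_simps power2_eq_square\<close>)
qed

text \<open>Induction on the number of nonzero diagonal entries: a transvection merges two of them
  into one place, provided an off-diagonal entry between their positions is nonzero.\<close>

lemma traceless_similar_zero_diag:
  fixes T :: "'a::field_char_0 mat"
  assumes "T \<in> carrier_mat n n" "(\<Sum>i<n. T $$ (i, i)) = 0"
  shows "\<exists>T'\<in>carrier_mat n n. similar_mat T T' \<and> (\<forall>i<n. T' $$ (i, i) = 0)"
  using assms
proof (induction "card {i. i < n \<and> T $$ (i, i) \<noteq> 0}" arbitrary: T rule: less_induct)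
  case less
  note T = less.prems(1)
  \<comment> \<open>\<open>S\<close> may differ from \<open>T\<close> off the diagonal, so that a
    nonzero entry at \<open>(j, i)\<close> can be created first. The factor
    \<open>- S $$ (i, i) / S $$ (j, i)\<close> clears position \<open>i\<close> by moving its entry
    to position \<open>j\<close>, which was already counted as nonzero.\<close>
  have reduce: "\<exists>T'\<in>carrier_mat n n. similar_mat T T' \<and> (\<forall>i<n. T' $$ (i, i) = 0)"
    if S: "S \<in> carrier_mat n n" "similar_mat S T" "\<And>k. k < n \<Longrightarrow> S $$ (k, k) = T $$ (k, k)"
      and ij: "i < n" "j < n" "i \<noteq> j" "S $$ (j, i) \<noteq> 0" and nz: "T $$ (i, i) \<noteq> 0" "T $$ (j, j) \<noteq> 0"
    for S i j
  proof -
    obtain R where R: "similar_mat R S" "R \<in> carrier_mat n n"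
      "\<And>k. k < n \<Longrightarrow> k \<noteq> i \<Longrightarrow> k \<noteq> j \<Longrightarrow> R $$ (k, k) = S $$ (k, k)"
      "R $$ (i, i) = S $$ (i, i) + (- S $$ (i, i) / S $$ (j, i)) * S $$ (j, i)"
      "R $$ (j, j) = S $$ (j, j) - (- S $$ (i, i) / S $$ (j, i)) * S $$ (j, i)"
      by (rule similar_mat_transvection[OF S(1) ij(1-3), of "- S $$ (i, i) / S $$ (j, i)"]) (rule that)
    have Ri: "R $$ (i, i) = 0" using R(4) ij by simp
    have Rj: "R $$ (j, j) = S $$ (j, j) + S $$ (i, i)" using R(5) ij by simp
    have *: "{..<n} = insert i (insert j ({..<n} - {i, j}))" using ij by auto
    have "(\<Sum>k<n. R $$ (k, k)) = (\<Sum>k<n. S $$ (k, k))"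
      using ij by (subst (1 2) *) (simp add: Ri Rj R(3) sum.insert_remove)
    then have tr: "(\<Sum>k<n. R $$ (k, k)) = 0" using S(3) less.prems(2) by simp
    have "{k. k < n \<and> R $$ (k, k) \<noteq> 0} \<subset> {k. k < n \<and> T $$ (k, k) \<noteq> 0}"
    proof
      have "T $$ (k, k) \<noteq> 0" if "k < n" "R $$ (k, k) \<noteq> 0" for k
        using that R(3)[of k] S(3)[of k] Ri nz by (cases "k = i"; cases "k = j") auto
      then show "{k. k < n \<and> R $$ (k, k) \<noteq> 0} \<subseteq> {k. k < n \<and> T $$ (k, k) \<noteq> 0}" by blast
      show "{k. k < n \<and> R $$ (k, k) \<noteq> 0} \<noteq> {k. k < n \<and> T $$ (k, k) \<noteq> 0}"
        using Ri nz(1) ij(1) by blast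
    qed
    then have "card {k. k < n \<and> R $$ (k, k) \<noteq> 0} < card {k. k < n \<and> T $$ (k, k) \<noteq> 0}"
      by (rule psubset_card_mono[rotated]) auto
    from less.hyps[OF this R(2) tr] obtain T' where T': "T' \<in> carrier_mat n n" "similar_mat R T'"
      "\<forall>i<n. T' $$ (i, i) = 0" by blast
    have "similar_mat T T'"
      by (rule similar_mat_trans[OF similar_mat_sym[OF S(2)] similar_mat_trans[OF similar_mat_sym[OF R(1)] T'(2)]])
    with T' show ?thesis by blast
  qed
  show ?case
  proof (cases "\<forall>i<n. T $$ (i, i) = 0")
    case True
    then show ?thesis using T similar_mat_refl by blast
  next
    case False
    then obtain i where i: "i < n" "T $$ (i, i) \<noteq> 0" by auto
    \<comment> \<open>If all nonzero diagonal entries were equal, the trace would be a positive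
      integer multiple of one of them, which is nonzero in characteristic 0.\<close>
    have "\<exists>j<n. T $$ (j, j) \<noteq> 0 \<and> T $$ (j, j) \<noteq> T $$ (i, i)"
    proof (rule ccontr)
      assume "\<not> ?thesis"
      then have "(\<Sum>j<n. T $$ (j, j)) = (\<Sum>j<n. if T $$ (j, j) \<noteq> 0 then T $$ (i, i) else 0)"
        by (intro sum.cong) auto
      also have "\<dots> = of_nat (card {j. j < n \<and> T $$ (j, j) \<noteq> 0}) * T $$ (i, i)"
        by (simp add: sum.If_cases lessThan_def Collect_conj_eq)
      finally have "card {j. j < n \<and> T $$ (j, j) \<noteq> 0} = 0" using i less.prems(2) by simp
      with i show False by auto
    qed
    then obtain j where j: "j < n" "T $$ (j, j) \<noteq> 0" "T $$ (j, j) \<noteq> T $$ (i, i)" by blast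
    then have ne: "i \<noteq> j" by auto
    consider "T $$ (j, i) \<noteq> 0" | "T $$ (i, j) \<noteq> 0" | "T $$ (j, i) = 0" "T $$ (i, j) = 0" by blast
    then show ?thesis
    proof cases
      case 1
      then show ?thesis using reduce[OF T similar_mat_refl[OF T] _ i(1) j(1) ne] i j by simp
    next
      case 2
      then show ?thesis using reduce[OF T similar_mat_refl[OF T] _ j(1) i(1) ne[symmetric]] i j by simp
    next
      case 3
      \<comment> \<open>With both off-diagonal entries zero, the factor 1 leaves the diagonal
        unchanged and puts \<open>T $$ (j, j) - T $$ (i, i) \<noteq> 0\<close> at
        \<open>(i, j)\<close>.\<close>
      obtain S where S: "similar_mat S T" "S \<in> carrier_mat n n"
        "\<And>k. k < n \<Longrightarrow> k \<noteq> i \<Longrightarrow> k \<noteq> j \<Longrightarrow> S $$ (k, k) = T $$ (k, k)"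
        "S $$ (i, i) = T $$ (i, i) + 1 * T $$ (j, i)" "S $$ (j, j) = T $$ (j, j) - 1 * T $$ (j, i)"
        "S $$ (i, j) = T $$ (i, j) + 1 * (T $$ (j, j) - T $$ (i, i)) - 1\<^sup>2 * T $$ (j, i)"
        by (rule similar_mat_transvection[OF T i(1) j(1) ne, of 1]) (rule that)
      have "S $$ (k, k) = T $$ (k, k)" if "k < n" for k
        using S(3)[OF that] S(4,5) 3 by (cases "k = i"; cases "k = j") auto
      moreover have "S $$ (i, j) \<noteq> 0" using S(6) 3 j by simp
      ultimately show ?thesis using reduce[OF S(2,1) _ j(1) i(1) ne[symmetric]] i j by simp
    qed
  qed
qed

text \<open>Once the diagonal is zero, the strictly upper and the strictly lower part are both
  nilpotent, and each contributes two summands.\<close>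

lemma traceless_sum_four:
  fixes T :: "'a::field_char_0 mat"
  assumes \<D>: "\<D> \<subseteq> carrier_mat n n"
    and C: "\<And>r. r \<le> n div 2 \<Longrightarrow> offset_unit_mat n (n div 2) r \<in> \<D>"
    and sim: "\<And>D E. D \<in> \<D> \<Longrightarrow> similar_mat E D \<Longrightarrow> E \<in> \<D>"
    and T: "T \<in> carrier_mat n n" and tr: "mat_trace T = 0"
  shows "\<exists>D\<^sub>1\<in>\<D>. \<exists>D\<^sub>2\<in>\<D>. \<exists>D\<^sub>3\<in>\<D>. \<exists>D\<^sub>4\<in>\<D>. T = D\<^sub>1 + D\<^sub>2 + D\<^sub>3 + D\<^sub>4"
proof -
  have "(\<Sum>i<n. T $$ (i, i)) = 0"
    using tr T by (simp add: mat_trace_def diag_mat_def interv_sum_list_conv_sum_set_nat lessThan_atLeast0)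
  then obtain Z where Z: "Z \<in> carrier_mat n n" "similar_mat T Z" "\<And>i. i < n \<Longrightarrow> Z $$ (i, i) = 0"
    using traceless_similar_zero_diag[OF T] by blast
  define U L where "U = mat n n (\<lambda>(i, j). if i < j then Z $$ (i, j) else 0)"
    and "L = mat n n (\<lambda>(i, j). if j < i then Z $$ (i, j) else 0)"
  have UL: "U \<in> carrier_mat n n" "L \<in> carrier_mat n n" by (auto simp: U_def L_def)
  have "Z = U + L"
  proof (rule eq_matI)
    fix i j assume "i < dim_row (U + L)" "j < dim_col (U + L)"
    then have "i < n" "j < n" by (auto simp: U_def L_def)
    then show "Z $$ (i, j) = (U + L) $$ (i, j)"
      using Z(3) by (cases i j rule: linorder_cases) (auto simp: U_def L_def)
  qed (use Z in \<open>auto simp: U_def L_def\<close>)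
  then obtain U' L' where U': "similar_mat U' U" and L': "similar_mat L' L" and T_eq: "T = U' + L'"
    using similar_mat_add[of T U L n] Z(2) UL by blast
  have two: "\<exists>D\<in>\<D>. \<exists>E\<in>\<D>. X = D + E" if X: "similar_mat X V" and V: "V \<in> carrier_mat n n"
    and V0: "\<And>i j. i < n \<Longrightarrow> j \<le> i \<Longrightarrow> V $$ (i, j) = 0" for X V
  proof -
    have "\<exists>D\<in>\<D>. \<exists>E\<in>\<D>. V = D + E"
      by (rule strictly_upper_sum_two[OF C sim V V0])
    then obtain D E where DE: "D \<in> \<D>" "E \<in> \<D>" "V = D + E" by blast
    moreover obtain D' E' where "similar_mat D' D" "similar_mat E' E" "X = D' + E'"
      using similar_mat_add[of X D E n] X DE \<D> by blast
    ultimately show ?thesis using sim by blast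
  qed
  obtain D\<^sub>1 D\<^sub>2 where D12: "D\<^sub>1 \<in> \<D>" "D\<^sub>2 \<in> \<D>" "U' = D\<^sub>1 + D\<^sub>2"
    using two[OF U' UL(1)] by (auto simp: U_def)
  \<comment> \<open>Reversing the order of the indices turns the strictly lower part into a strictly
    upper one.\<close>
  define \<rho> where "\<rho> i = n - 1 - i" for i
  have \<rho>: "bij_betw \<rho> {..<n} {..<n}"
    by (rule bij_betw_byWitness[where f' = \<rho>]) (auto simp: \<rho>_def)
  let ?V = "mat n n (\<lambda>(i, j). L $$ (\<rho> i, \<rho> j))"
  have "similar_mat L' ?V"
    using L' similar_mat_permute[OF UL(2) \<rho>] similar_mat_sym similar_mat_trans by blast
  moreover have "?V $$ (i, j) = 0" if "i < n" "j \<le> i" for i j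
    using that by (auto simp: L_def \<rho>_def)
  ultimately obtain D\<^sub>3 D\<^sub>4 where D34: "D\<^sub>3 \<in> \<D>" "D\<^sub>4 \<in> \<D>" "L' = D\<^sub>3 + D\<^sub>4"
    using two[of L' ?V] by auto
  have "T = D\<^sub>1 + D\<^sub>2 + D\<^sub>3 + D\<^sub>4"
    unfolding T_eq D12(3) D34(3)
    by (rule assoc_add_mat[symmetric, of _ n n]) (use D12 D34 \<D> in auto)
  then show ?thesis using D12 D34 by blast
qed

section \<open>Triangular form with prescribed diagonal\<close>

lemma char_poly_linear_factors:
  fixes A :: "'a::alg_closed_field mat"
  assumes "A \<in> carrier_mat n n"
  obtains es where "char_poly A = (\<Prod>e\<leftarrow>es. [:- e, 1:])" "length es = n"
proof -
  have cp: "degree (char_poly A) = n" "lead_coeff (char_poly A) = 1"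
    using degree_monic_char_poly[OF assms] by auto
  then have "char_poly A \<noteq> 0" by auto
  then obtain M where M: "size M = n" "char_poly A = (\<Prod>x\<in>#M. [:- x, 1:])"
    using alg_closed_imp_factorization[of "char_poly A"] cp by auto
  obtain es where "mset es = M" using ex_mset by blast
  then show ?thesis using that[of es] M by (metis mset_map prod_mset_prod_list size_mset)
qed

lemma order_prod_linear_factors:
  "order x (\<Prod>e\<leftarrow>es. [:- e, 1:]) = count_list es (x::'a::idom)"
proof (induction es)
  case (Cons e es)
  have "order x [:- e, 1:] = (if e = x then 1 else 0)"
    using order_power_n_n[of x 1] by (auto intro: order_0I)
  moreover have nz: "[:- e, 1:] * (\<Prod>e\<leftarrow>es. [:- e, 1:]) \<noteq> 0"
    unfolding mult_eq_0_iff by (auto simp: prod_list_zero_iff)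
  ultimately show ?case unfolding list.map prod_list.Cons order_mult[OF nz] using Cons by simp
qed (auto simp: order_0I)

text \<open>The point is that the order of the eigenvalues on the diagonal can be prescribed. An
  eigenvector for the first one is completed to a basis, and the induction continues with the
  complementary block.\<close>

lemma similar_mat_upper_triangular:
  fixes A :: "'a::field mat"
  assumes "A \<in> carrier_mat n n" "char_poly A = (\<Prod>e\<leftarrow>es. [:- e, 1:])"
  shows "\<exists>B. similar_mat A B \<and> upper_triangular B \<and> diag_mat B = es"
  using assms
proof (induction es arbitrary: n A)
  case Nil
  then have "n = 0" using degree_monic_char_poly[OF Nil.prems(1)] by simp
  then show ?case using Nil similar_mat_refl[OF Nil.prems(1)] by (intro exI[of _ A]) (auto simp: diag_mat_def)
next
  case (Cons e es n A)
  note A = Cons.prems(1)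
  have cp: "char_poly A = [:- e, 1:] * (\<Prod>e\<leftarrow>es. [:- e, 1:])" using Cons.prems(2) by simp
  have "eigenvalue A e" unfolding eigenvalue_root_char_poly[OF A] cp by simp
  then obtain v where v: "v \<in> carrier_vec n" "v \<noteq> 0\<^sub>v n" "A *\<^sub>v v = e \<cdot>\<^sub>v v"
    using A by (auto simp: eigenvalue_def eigenvector_def)
  obtain k where k: "k < n" "v $ k \<noteq> 0" using v(1,2) by (metis carrier_vecD eq_vecI index_zero_vec)
  then obtain m where m: "n = Suc m" by (cases n) auto
  \<comment> \<open>\<open>\<sigma>\<close> swaps 0 and \<open>k\<close>. The columns of
    \<open>P\<close> are then \<open>v\<close> and the unit vectors other than the
    \<open>k\<close>-th, a basis because \<open>v $ k \<noteq> 0\<close>.\<close>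
  define \<sigma> where "\<sigma> i = (if i = 0 then k else if i = k then 0 else i)" for i
  have \<sigma>: "\<sigma> (\<sigma> i) = i" "\<sigma> i < n \<longleftrightarrow> i < n" "\<sigma> k = 0" for i using k m by (auto simp: \<sigma>_def)
  define P where "P = mat n n (\<lambda>(i, j). if j = 0 then v $ i else if j = \<sigma> i then 1 else 0)"
  have P: "P \<in> carrier_mat n n" by (simp add: P_def)
  have detP: "det P \<noteq> 0"
  proof (rule det_nonzeroI[OF P])
    fix x assume x: "\<And>i. i < n \<Longrightarrow> (\<Sum>j<n. P $$ (i, j) * x j) = 0"
    have Px: "v $ i * x 0 + (if \<sigma> i = 0 then 0 else x (\<sigma> i)) = 0" if "i < n" for i
    proof -
      have "(\<Sum>j<n. P $$ (i, j) * x j)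
          = (\<Sum>j<n. (if j = 0 then v $ i * x 0 else 0) + (if j = \<sigma> i then (if \<sigma> i = 0 then 0 else x (\<sigma> i)) else 0))"
        by (rule sum.cong) (use that in \<open>auto simp: P_def\<close>)
      moreover have "0 < n" using m by simp
      ultimately show ?thesis using that \<sigma>(2)[of i] x[OF that] by (simp add: sum.distrib)
    qed
    have x0: "x 0 = 0" using Px[OF k(1)] k \<sigma> by simp
    have "x j = 0" if "j < n" for j
      using Px[of "\<sigma> j"] that \<sigma> x0 by (cases "j = 0") auto
    then show "\<forall>j<n. x j = 0" by blast
  qed
  obtain Q where Q: "Q \<in> carrier_mat n n" "Q * P = 1\<^sub>m n" "P * Q = 1\<^sub>m n"
    using det_non_zero_imp_unit[OF P detP, of "()"] by (auto simp: Units_def ring_mat_def)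
  define A' where "A' = Q * A * P"
  have A': "A' \<in> carrier_mat n n" using A P Q by (simp add: A'_def)
  have sim: "similar_mat A' A"
    by (rule similar_matI[of _ _ Q P n]) (use A A' P Q in \<open>auto simp: A'_def\<close>)
  have colP: "col P 0 = v"
    using v(1) m by (intro eq_vecI) (auto simp: P_def)
  have "col A' 0 = Q *\<^sub>v (A *\<^sub>v col P 0)"
  proof -
    have AP: "A * P \<in> carrier_mat n n" and n0: "0 < n" using A P m by auto
    show ?thesis
      unfolding A'_def assoc_mult_mat[OF Q(1) A P] col_mult2[OF Q(1) AP n0] col_mult2[OF A P n0] ..
  qed
  also have "\<dots> = e \<cdot>\<^sub>v (Q *\<^sub>v col P 0)"
    unfolding colP v(3) using v(1) Q by (simp add: mult_mat_vec[of _ n n])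
  also have "Q *\<^sub>v col P 0 = col (Q * P) 0" by (rule col_mult2[OF Q(1) P, symmetric]) (simp add: m)
  finally have colA': "col A' 0 = e \<cdot>\<^sub>v col (1\<^sub>m n) 0" by (simp only: Q(2))
  have col0: "A' $$ (i, 0) = (if i = 0 then e else 0)" if "i < n" for i
  proof -
    have "A' $$ (i, 0) = col A' 0 $ i" using A' m that by simp
    also have "\<dots> = (if i = 0 then e else 0)" unfolding colA' using that m by simp
    finally show ?thesis .
  qed
  define A1 A2 A3 where "A1 = mat 1 1 (\<lambda>_. e)" and "A2 = mat 1 m (\<lambda>(i, j). A' $$ (0, Suc j))"
    and "A3 = mat m m (\<lambda>(i, j). A' $$ (Suc i, Suc j))"
  have c: "A1 \<in> carrier_mat 1 1" "A2 \<in> carrier_mat 1 m" "A3 \<in> carrier_mat m m"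
    by (auto simp: A1_def A2_def A3_def)
  have A'_block: "A' = four_block_mat A1 A2 (0\<^sub>m m 1) A3"
    by (rule eq_matI) (use A' m col0 in \<open>auto simp: A1_def A2_def A3_def\<close>)
  have "[:- e, 1:] * (\<Prod>e\<leftarrow>es. [:- e, 1:]) = char_poly A1 * char_poly A3"
    using cp char_poly_similar[OF sim] char_poly_four_block_zeros_col[OF c] A'_block by simp
  moreover have ut1: "upper_triangular A1" by (rule upper_triangularI) (simp add: A1_def)
  have "char_poly A1 = [:- e, 1:]"
    using char_poly_upper_triangular[OF c(1) ut1] by (simp add: A1_def diag_mat_def)
  ultimately have "char_poly A3 = (\<Prod>e\<leftarrow>es. [:- e, 1:])"
    by (metis mult_left_cancel one_neq_zero pCons_eq_0_iff)
  from Cons.IH[OF c(3) this] obtain B where B: "similar_mat A3 B" "upper_triangular B" "diag_mat B = es"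
    by blast
  obtain P' Q' where wit: "similar_mat_wit A3 B P' Q'" using B(1) by (auto simp: similar_mat_def)
  note PQ' = similar_mat_witD2[OF c(3) wit]
  \<comment> \<open>The similarity of \<open>A3\<close> and \<open>B\<close> is extended by the
    identity on the first coordinate, which turns the rest of the first row into
    \<open>A2 * P'\<close>.\<close>
  have "similar_mat_wit A' (four_block_mat A1 (A2 * P') (0\<^sub>m m 1) B)
     (four_block_mat (1\<^sub>m 1) (0\<^sub>m 1 m) (0\<^sub>m m 1) P') (four_block_mat (1\<^sub>m 1) (0\<^sub>m 1 m) (0\<^sub>m m 1) Q')"
    unfolding A'_block
    by (rule similar_mat_wit_four_block[OF similar_mat_wit_refl[OF c(1)] wit _ _ c(1) c(3)])
      (use c PQ' in \<open>auto simp: assoc_mult_mat[of _ 1 m _ m _ m]\<close>)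
  then have "similar_mat A' (four_block_mat A1 (A2 * P') (0\<^sub>m m 1) B)"
    unfolding similar_mat_def by blast
  then have "similar_mat A (four_block_mat A1 (A2 * P') (0\<^sub>m m 1) B)"
    by (rule similar_mat_trans[OF similar_mat_sym[OF sim]])
  moreover have "upper_triangular (four_block_mat A1 (A2 * P') (0\<^sub>m m 1) B)"
    by (rule upper_triangular_four_block[OF c(1) PQ'(5) ut1 B(2)])
  moreover have "diag_mat (four_block_mat A1 (A2 * P') (0\<^sub>m m 1) B) = e # es"
    using diag_four_block_mat[OF c(1) PQ'(5)] B(3) by (simp add: A1_def diag_mat_def)
  ultimately show ?case by blast
qed

text \<open>Sorting makes equal entries contiguous. If positions \<open>i\<close> and
  \<open>h + i\<close> agreed, the \<open>h + 1\<close> positions from one to the other would carry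
  a single value, which is more than allowed.\<close>

lemma arrange_distinct_halves:
  fixes es :: "'a list"
  assumes few: "\<And>x. count_list es x \<le> length es div 2"
  obtains cs where "mset cs = mset es"
    "\<And>i. i < length es div 2 \<Longrightarrow> cs ! i \<noteq> cs ! (length es div 2 + i)"
proof -
  define h where "h = length es div 2"
  \<comment> \<open>The entries carry no order, so they are sorted along an injection of their
    finite set into the natural numbers.\<close>
  obtain key :: "'a \<Rightarrow> nat" where key: "inj_on key (set es)"
    using finite_imp_inj_to_nat_seg[of "set es"] by auto
  define cs where "cs = sort_key key es"
  have cs: "mset cs = mset es" "sorted (map key cs)" by (auto simp: cs_def)
  then have len: "length cs = length es" and set: "set cs = set es"
    using mset_eq_length mset_eq_setD by blast+
  have "cs ! i \<noteq> cs ! (h + i)" if i: "i < h" for i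
  proof
    assume eq: "cs ! i = cs ! (h + i)"
    have hi: "h + i < length cs" using i by (simp add: h_def len)
    have same: "cs ! l = cs ! i" if l: "l \<in> {i..h + i}" for l
    proof -
      have "key (cs ! i) \<le> key (cs ! l)" "key (cs ! l) \<le> key (cs ! (h + i))"
        using sorted_nth_mono[OF cs(2), of i l] sorted_nth_mono[OF cs(2), of l "h + i"] l hi by auto
      then have "key (cs ! l) = key (cs ! i)" using eq by simp
      moreover have "cs ! l \<in> set es" "cs ! i \<in> set es"
        using set l hi nth_mem[of l cs] nth_mem[of i cs] by auto
      ultimately show ?thesis using inj_onD[OF key] by blast
    qed
    have "{i..h + i} \<subseteq> {l. l < length cs \<and> cs ! l = cs ! i}"
    proof
      fix l assume "l \<in> {i..h + i}"
      with same[OF this] hi show "l \<in> {l. l < length cs \<and> cs ! l = cs ! i}" by simp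
    qed
    from card_mono[OF _ this] have "Suc h \<le> card {l. l < length cs \<and> cs ! l = cs ! i}" by simp
    also have "\<dots> = count_list cs (cs ! i)"
      by (simp add: count_list_eq_length_filter length_filter_conv_card eq_commute)
    also have "\<dots> = count_list es (cs ! i)" using cs(1) by (simp flip: count_mset)
    finally show False using few[of "cs ! i"] by (simp add: h_def)
  qed
  then show ?thesis using that cs(1) by (simp add: h_def)
qed

text \<open>The eigenvalues are listed with differing halves and placed on the diagonal in that
  order. For odd \<open>n\<close> the last one lies in neither half.\<close>

lemma similar_mat_distinct_halves:
  fixes X :: "'a::alg_closed_field mat"
  assumes X: "X \<in> carrier_mat n n" and mult: "\<And>x. order x (char_poly X) \<le> n div 2"
  obtains B where "similar_mat X B" "B \<in> carrier_mat n n" "upper_triangular B"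
    "\<And>i. i < n div 2 \<Longrightarrow> B $$ (i, i) \<noteq> B $$ (n div 2 + i, n div 2 + i)"
proof -
  obtain es where es: "char_poly X = (\<Prod>e\<leftarrow>es. [:- e, 1:])" "length es = n"
    by (rule char_poly_linear_factors[OF X])
  have "count_list es x \<le> length es div 2" for x
    using mult[of x] by (simp add: es order_prod_linear_factors)
  then obtain cs where cs: "mset cs = mset es"
    "\<And>i. i < length es div 2 \<Longrightarrow> cs ! i \<noteq> cs ! (length es div 2 + i)"
    by (rule arrange_distinct_halves) (rule that)
  have "char_poly X = (\<Prod>e\<leftarrow>cs. [:- e, 1:])"
    using cs(1) es(1) by (metis mset_map prod_mset_prod_list)
  then obtain B where B: "similar_mat X B" "upper_triangular B" "diag_mat B = cs"
    using similar_mat_upper_triangular[OF X] by blast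
  have Bc: "B \<in> carrier_mat n n" using similar_matD[OF B(1)] X by auto
  have "B $$ (i, i) = cs ! i" if "i < n" for i
    using B(3) Bc that by (auto simp: diag_mat_def)
  then show ?thesis using that[OF B(1) Bc B(2)] cs(2) es(2) by simp
qed

section \<open>Openness of bounded eigenvalue multiplicity\<close>

text \<open>
  The format depends on the degree bound \<open>n\<close> and not on the degrees, so that it is preserved by
  every specialization of the coefficients.
\<close>

definition sylvester_cols :: "nat \<Rightarrow> 'a::comm_ring_1 poly \<Rightarrow> 'a poly \<Rightarrow> 'a mat" where
  "sylvester_cols n p q = mat (n + n) (n + n) (\<lambda>(i, j).
     if j < n then coeff (monom 1 j * p) i else coeff (monom 1 (j - n) * q) i)"

lemma sylvester_cols_carrier [simp]: "sylvester_cols n p q \<in> carrier_mat (n + n) (n + n)"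
  by (simp add: sylvester_cols_def)

lemma (in comm_ring_hom) sylvester_cols_map_poly:
  "sylvester_cols n (map_poly hom p) (map_poly hom q) = map_mat hom (sylvester_cols n p q)"
  by (rule eq_matI) (auto simp: sylvester_cols_def coeff_monom_mult hom_distribs)

text \<open>Each column is the coefficient vector of a multiple of \<open>p\<close> or
  \<open>q\<close>, and pairing it with the vector of powers of \<open>x\<close> evaluates that
  multiple at \<open>x\<close>. The powers therefore form a left kernel vector.\<close>

lemma det_sylvester_cols_common_root:
  fixes p q :: "'a::field poly"
  assumes "degree p \<le> n" "degree q \<le> n" "n > 0" and root: "poly p x = 0" "poly q x = 0"
  shows "det (sylvester_cols n p q) = 0"
proof -
  let ?S = "sylvester_cols n p q" and ?v = "vec (n + n) (\<lambda>i. x ^ i)"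
  have eval: "(\<Sum>i<n + n. coeff (monom 1 j * r) i * x ^ i) = 0"
    if "j < n" "degree r \<le> n" "poly r x = 0" for j and r :: "'a poly"
  proof -
    have "degree (monom 1 j * r) < n + n"
      using degree_mult_le[of "monom 1 j" r] degree_monom_le[of "1::'a" j] that by linarith
    then have "poly (monom 1 j * r) x = (\<Sum>i<n + n. coeff (monom 1 j * r) i * x ^ i)"
      unfolding poly_altdef by (intro sum.mono_neutral_left) (auto simp: coeff_eq_0)
    then show ?thesis using that by simp
  qed
  have "transpose_mat ?S *\<^sub>v ?v = 0\<^sub>v (n + n)"
  proof (rule eq_vecI)
    fix j assume "j < dim_vec (0\<^sub>v (n + n) :: 'a vec)"
    then have j: "j < n + n" by simp
    have "(transpose_mat ?S *\<^sub>v ?v) $ j = (\<Sum>i<n + n. ?S $$ (i, j) * x ^ i)"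
      using j by (simp add: scalar_prod_def lessThan_atLeast0 sylvester_cols_def)
    also have "\<dots> = 0"
      using eval[of j p] eval[of "j - n" q] assms j
      by (cases "j < n") (auto simp: sylvester_cols_def)
    finally show "(transpose_mat ?S *\<^sub>v ?v) $ j = 0\<^sub>v (n + n) $ j" using j by simp
  qed (simp add: sylvester_cols_def)
  moreover have "?v \<noteq> 0\<^sub>v (n + n)"
  proof
    assume "?v = 0\<^sub>v (n + n)"
    from arg_cong[OF this, of "\<lambda>w. w $ 0"] \<open>n > 0\<close> show False by simp
  qed
  ultimately have "det (transpose_mat ?S) = 0"
    by (subst det_0_iff_vec_prod_zero_field[of _ "n + n"]) (auto intro!: exI[of _ ?v])
  then show ?thesis by (simp add: det_transpose[OF sylvester_cols_carrier])
qed

text \<open>A coprimality argument done root by root: the linear factor of \<open>e\<close> divides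
  \<open>v * q\<close> but not \<open>q\<close>, hence divides \<open>v\<close>. Cancelling it
  before continuing takes care of repeated roots.\<close>

lemma prod_linear_factors_dvd:
  fixes v q :: "'a::field poly"
  assumes "\<And>e. e \<in> set es \<Longrightarrow> poly q e \<noteq> 0" "(\<Prod>e\<leftarrow>es. [:- e, 1:]) dvd v * q"
  shows "(\<Prod>e\<leftarrow>es. [:- e, 1:]) dvd v"
  using assms
proof (induction es arbitrary: v)
  case (Cons e es)
  obtain k where "v * q = (\<Prod>e\<leftarrow>e # es. [:- e, 1:]) * k"
    using Cons.prems(2) by (rule dvdE)
  then have k: "v * q = [:- e, 1:] * ((\<Prod>e\<leftarrow>es. [:- e, 1:]) * k)"
    by (simp only: list.map prod_list.Cons mult.assoc)
  have "poly (v * q) e = 0" unfolding k by simp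
  then have "poly v e = 0" using Cons.prems(1)[of e] by simp
  then obtain w where w: "v = [:- e, 1:] * w" unfolding poly_eq_0_iff_dvd by (rule dvdE)
  have "[:- e, 1:] * (w * q) = [:- e, 1:] * ((\<Prod>e\<leftarrow>es. [:- e, 1:]) * k)"
    using k by (simp only: w mult.assoc)
  then have "w * q = (\<Prod>e\<leftarrow>es. [:- e, 1:]) * k"
    by (subst (asm) mult_left_cancel) simp_all
  then have d: "(\<Prod>e\<leftarrow>es. [:- e, 1:]) dvd w * q" by simp
  have "(\<Prod>e\<leftarrow>es. [:- e, 1:]) dvd w" by (rule Cons.IH[OF _ d]) (use Cons.prems(1) in auto)
  then show ?case unfolding w by (simp only: list.map prod_list.Cons mult_dvd_mono dvd_refl)
qed simp

text \<open>A kernel vector encodes \<open>u\<close> and \<open>v\<close> with coefficients only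
  below index \<open>n\<close> and \<open>u * p + v * q = 0\<close>. Then \<open>p\<close> divides
  \<open>v * q\<close> and, sharing no root with \<open>q\<close>, divides \<open>v\<close>. As
  \<open>p\<close> has degree exactly \<open>n\<close>, this forces \<open>v = 0\<close> and then
  \<open>u = 0\<close>.\<close>

lemma det_sylvester_cols_no_common_root:
  fixes q :: "'a::field poly"
  assumes p: "p = (\<Prod>e\<leftarrow>es. [:- e, 1:])" and len: "length es = n" and q: "degree q \<le> n"
    and no: "\<And>x. poly p x = 0 \<Longrightarrow> poly q x \<noteq> 0"
  shows "det (sylvester_cols n p q) \<noteq> 0"
proof (rule det_nonzeroI[OF sylvester_cols_carrier])
  have deg: "degree p = n" and lc: "p \<noteq> 0"
  proof -
    have "degree (\<Prod>e\<leftarrow>es. [:- e, 1:]) = length es \<and> (\<Prod>e\<leftarrow>es. [:- e, 1:]) \<noteq> 0"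
    proof (induction es)
      case (Cons e es)
      then show ?case by (simp only: list.map prod_list.Cons) (simp add: degree_mult_eq del: mult_pCons_left)
    qed simp
    then show "degree p = n" "p \<noteq> 0" by (auto simp: p len)
  qed
  fix w assume w: "\<And>i. i < n + n \<Longrightarrow> (\<Sum>j<n + n. sylvester_cols n p q $$ (i, j) * w j) = 0"
  define u v where "u = (\<Sum>j<n. monom (w j) j)" and "v = (\<Sum>j<n. monom (w (n + j)) j)"
  have cu: "coeff u j = (if j < n then w j else 0)" and cv: "coeff v j = (if j < n then w (n + j) else 0)" for j
    by (simp_all add: u_def v_def coeff_sum if_distrib sum.delta' cong: if_cong)
  have "coeff (u * p + v * q) i = 0" for i
  proof (cases "i < n + n")
    case True
    have monom: "coeff (monom c j * r) i = coeff (monom 1 j * r) i * c" for c j and r :: "'a poly"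
      by (simp add: coeff_monom_mult)
    have "coeff (u * p + v * q) i
        = (\<Sum>j<n. coeff (monom 1 j * p) i * w j) + (\<Sum>j<n. coeff (monom 1 j * q) i * w (n + j))"
      unfolding u_def v_def sum_distrib_right coeff_add coeff_sum
      by (simp only: monom[of "w _"])
    also have "\<dots> = (\<Sum>j<n. sylvester_cols n p q $$ (i, j) * w j)
        + (\<Sum>j<n. sylvester_cols n p q $$ (i, n + j) * w (n + j))"
      using True by (simp add: sylvester_cols_def)
    also have "\<dots> = (\<Sum>j<n + n. sylvester_cols n p q $$ (i, j) * w j)"
      using sum.shift_bounds_nat_ivl[of "\<lambda>j. sylvester_cols n p q $$ (i, j) * w j" 0 n n]
      by (simp add: lessThan_atLeast0 sum.atLeastLessThan_concat[symmetric, of 0 n "n + n"] add.commute)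
    finally show ?thesis using w[OF True] by simp
  next
    case False
    have "degree u \<le> n - 1" "degree v \<le> n - 1"
      by (rule degree_le; use cu cv in auto)+
    then have "degree (u * p + v * q) \<le> n - 1 + n"
      using deg q by (intro degree_add_le order_trans[OF degree_mult_le] add_mono) auto
    \<comment> \<open>For \<open>n = 0\<close> the subtraction in \<open>n - 1\<close> truncates and
      the degree bound is too weak.\<close>
    moreover have "u * p + v * q = 0" if "n = 0" using that by (simp add: u_def v_def)
    ultimately have "u * p + v * q = 0 \<or> degree (u * p + v * q) < i" using False by linarith
    then show ?thesis by (metis coeff_0 coeff_eq_0)
  qed
  then have eq: "u * p + v * q = 0" by (simp add: poly_eq_iff)
  then have "v * q = p * (- u)" by (simp add: algebra_simps eq_neg_iff_add_eq_0)
  then have "p dvd v * q" by (rule dvdI)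
  then have "p dvd v"
    unfolding p by (rule prod_linear_factors_dvd[rotated]) (use no in \<open>auto simp: p poly_prod_list prod_list_zero_iff\<close>)
  have v0: "v = 0"
  proof (rule ccontr)
    assume "v \<noteq> 0"
    with dvd_imp_degree_le[OF \<open>p dvd v\<close>] deg have "n \<le> degree v" by simp
    then have "coeff v (degree v) = 0" by (simp add: cv)
    with \<open>v \<noteq> 0\<close> show False by simp
  qed
  with eq lc have u0: "u = 0" by simp
  show "\<forall>j<n + n. w j = 0"
  proof (intro allI impI)
    fix j assume "j < n + n"
    then show "w j = 0"
      using cu[of j] cv[of "j - n"] by (cases "j < n") (simp_all add: u0 v0 split: if_splits)
  qed
qed

section \<open>Multiplicities through derivatives\<close>

lemma iterated_pderiv_order:
  fixes p :: "'a::field_char_0 poly"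
  assumes "p \<noteq> 0" "i \<le> order x p"
  shows "(pderiv ^^ i) p \<noteq> 0 \<and> order x ((pderiv ^^ i) p) = order x p - i"
  using assms(2)
proof (induction i)
  case (Suc i)
  let ?r = "(pderiv ^^ i) p"
  have r: "?r \<noteq> 0" "order x ?r = order x p - i" using Suc by auto
  then have "order x ?r \<noteq> 0" using Suc.prems by simp
  then have "poly ?r x = 0" by (auto simp: order_root)
  \<comment> \<open>In characteristic 0 differentiation lowers the order of a root by exactly
    one.\<close>
  from order_pderiv[OF r(1) this] have "order x ?r = Suc (order x (pderiv ?r))" .
  moreover have "pderiv ?r \<noteq> 0"
  proof
    assume "pderiv ?r = 0"
    then obtain c where "?r = [:c:]" using pderiv_iszero by blast
    with \<open>poly ?r x = 0\<close> r(1) show False by simp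
  qed
  ultimately show ?case using r by simp
qed (use assms(1) in simp)

text \<open>
  For generic \<open>u\<close>, a root of \<open>p\<close> is a root of this combination iff its multiplicity exceeds \<open>m\<close>.
\<close>

definition pderiv_combination :: "nat \<Rightarrow> 'a::idom \<Rightarrow> 'a poly \<Rightarrow> 'a poly" where
  "pderiv_combination m u p = (\<Sum>i=1..m. smult (u ^ i) ((pderiv ^^ i) p))"

lemma (in idom_hom) map_poly_pderiv_combination:
  "map_poly hom (pderiv_combination m u p) = pderiv_combination m (hom u) (map_poly hom p)"
proof -
  interpret map_poly_hom: map_poly_idom_hom hom ..
  have "map_poly hom ((pderiv ^^ i) p) = (pderiv ^^ i) (map_poly hom p)" for i
    by (induction i) (simp_all add: map_poly_pderiv)
  then show ?thesis
    by (simp add: pderiv_combination_def map_poly_hom.hom_sum hom_distribs)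
qed

lemma degree_pderiv_combination: "degree (pderiv_combination m u p) \<le> degree p"
proof -
  have "degree ((pderiv ^^ i) p) \<le> degree p" for i
    by (induction i) (auto intro: order_trans[OF degree_pderiv_le])
  then show ?thesis unfolding pderiv_combination_def
    by (intro degree_sum_le) (auto intro: order_trans[OF degree_smult_le])
qed

text \<open>At a fixed root \<open>x\<close> of order \<open>e\<close> the combination is a
  polynomial \<open>g x\<close> in \<open>u\<close>, whose coefficient at \<open>e\<close> is the
  nonzero value of the \<open>e\<close>-th derivative; \<open>1 \<le> e \<le> m\<close> puts this
  term inside the sum. There are finitely many roots, so some \<open>u\<close> avoids the zeros of
  all these polynomials.\<close>

lemma pderiv_combination_separates:
  fixes p :: "'a::field_char_0 poly"
  assumes p: "p \<noteq> 0" and mult: "\<And>x. order x p \<le> m"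
  obtains u where "\<And>x. poly p x = 0 \<Longrightarrow> poly (pderiv_combination m u p) x \<noteq> 0"
proof -
  define g where "g x = (\<Sum>i=1..m. monom (poly ((pderiv ^^ i) p) x) i)" for x
  have g: "poly (g x) u = poly (pderiv_combination m u p) x" for x u
    by (simp add: g_def pderiv_combination_def poly_sum poly_monom mult.commute)
  have gnz: "g x \<noteq> 0" if "poly p x = 0" for x
  proof -
    let ?e = "order x p"
    have e: "1 \<le> ?e" "?e \<le> m" using that p mult by (auto simp: order_root Suc_le_eq)
    have "(pderiv ^^ ?e) p \<noteq> 0" "order x ((pderiv ^^ ?e) p) = 0"
      using iterated_pderiv_order[OF p order_refl, of x] by auto
    then have "poly ((pderiv ^^ ?e) p) x \<noteq> 0" by (simp add: order_root)
    moreover have "coeff (g x) ?e = poly ((pderiv ^^ ?e) p) x"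
      using e by (simp add: g_def coeff_sum)
    ultimately show ?thesis by auto
  qed
  have fin: "finite {x. poly p x = 0}" by (rule poly_roots_finite[OF p])
  have "(\<Prod>x\<in>{x. poly p x = 0}. g x) \<noteq> 0" using fin gnz by auto
  then have "finite {u. poly (\<Prod>x\<in>{x. poly p x = 0}. g x) u = 0}" by (rule poly_roots_finite)
  then obtain u where "poly (\<Prod>x\<in>{x. poly p x = 0}. g x) u \<noteq> 0"
    using ex_new_if_finite[OF infinite_UNIV_char_0] by blast
  then have "poly (g x) u \<noteq> 0" if "poly p x = 0" for x
    using that fin by (auto simp: poly_prod)
  then show ?thesis using that g by metis
qed

text \<open>The Sylvester determinant of the characteristic polynomial and its derivative
  combination is a polynomial in the parameter. It is nonzero at 0, hence at all but finitely many
  parameters, and wherever it is nonzero no multiplicity exceeds \<open>m\<close>.\<close>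

lemma char_poly_order_open:
  fixes M :: "'a::{alg_closed_field, field_char_0} poly mat"
  assumes M: "M \<in> carrier_mat n n" and n: "n > 0"
    and mult: "\<And>x. order x (char_poly (map_mat (\<lambda>p. poly p 0) M)) \<le> m"
  obtains q where "q \<noteq> 0" "\<And>x. order x (char_poly (map_mat (\<lambda>p. poly p q) M)) \<le> m"
proof -
  define \<chi> where "\<chi> s = char_poly (map_mat (\<lambda>p. poly p s) M)" for s
  have \<chi>: "\<chi> s = map_poly (\<lambda>p. poly p s) (char_poly M)" for s
    unfolding \<chi>_def by (rule comm_ring_hom.char_poly_hom[OF poly_hom.comm_ring_hom_axioms M])
  have deg: "degree (\<chi> s) = n" and nz: "\<chi> s \<noteq> 0" for s
  proof -
    have "map_mat (\<lambda>p. poly p s) M \<in> carrier_mat n n" using M by simp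
    from degree_monic_char_poly[OF this] show "degree (\<chi> s) = n" "\<chi> s \<noteq> 0" by (auto simp: \<chi>_def)
  qed
  obtain u where u: "\<And>x. poly (\<chi> 0) x = 0 \<Longrightarrow> poly (pderiv_combination m u (\<chi> 0)) x \<noteq> 0"
    using pderiv_combination_separates[OF nz[of 0]] mult unfolding \<chi>_def by metis
  \<comment> \<open>\<open>u\<close> is chosen for parameter 0 and then kept constant. At the other
    parameters only the implication valid for every \<open>u\<close> is used: excessive multiplicity
    yields a common root.\<close>
  define S where "S = det (sylvester_cols n (char_poly M) (pderiv_combination m [:u:] (char_poly M)))"
  have S: "poly S s = det (sylvester_cols n (\<chi> s) (pderiv_combination m u (\<chi> s)))" for s
  proof -
    note hom = poly_hom.comm_ring_hom_axioms[where a = s]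
    show ?thesis
      unfolding S_def \<chi> comm_ring_hom.hom_det[OF hom, symmetric]
        comm_ring_hom.sylvester_cols_map_poly[OF hom, symmetric]
        idom_hom.map_poly_pderiv_combination[OF poly_hom.idom_hom_axioms] by simp
  qed
  obtain es where es: "\<chi> 0 = (\<Prod>e\<leftarrow>es. [:- e, 1:])" "length es = n"
    unfolding \<chi>_def by (rule char_poly_linear_factors[of "map_mat (\<lambda>p. poly p 0) M" n]) (use M in auto)
  have "poly S 0 \<noteq> 0"
    unfolding S by (rule det_sylvester_cols_no_common_root[OF es])
      (use degree_pderiv_combination[of m u "\<chi> 0"] deg u in auto)
  then have "S \<noteq> 0" by auto
  \<comment> \<open>Zero is excluded too, since later a matrix is scaled by a power of
    \<open>q\<close> and its diagonal entries must stay distinct.\<close>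
  then have "finite (insert 0 {s. poly S s = 0})" using poly_roots_finite by simp
  then obtain q where q: "q \<notin> insert 0 {s. poly S s = 0}"
    using ex_new_if_finite[OF infinite_UNIV_char_0] by blast
  have "order x (\<chi> q) \<le> m" for x
  proof (rule ccontr)
    assume "\<not> ?thesis"
    then have big: "m < order x (\<chi> q)" by simp
    \<comment> \<open>Multiplicity above \<open>m\<close> makes \<open>x\<close> a root of the
      polynomial and of its first \<open>m\<close> derivatives, hence of any combination of
      them.\<close>
    have root: "poly ((pderiv ^^ i) (\<chi> q)) x = 0" if "i \<le> m" for i
      using iterated_pderiv_order[OF nz, of i x q] big that by (simp add: order_root)
    have "poly S q = 0" unfolding S
    proof (rule det_sylvester_cols_common_root[OF _ _ n])
      show "poly (\<chi> q) x = 0" using root[of 0] by simp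
      show "poly (pderiv_combination m u (\<chi> q)) x = 0"
        by (simp add: pderiv_combination_def poly_sum root)
    qed (use deg degree_pderiv_combination[of m u "\<chi> q"] in auto)
    with q show False by simp
  qed
  then show ?thesis using that[of q] q by (simp add: \<chi>_def)
qed

section \<open>The graded evaluation\<close>

text \<open>
  Polynomial dependence on the matrices is only ever needed along lines.
\<close>

definition line_poly :: "nat \<Rightarrow> ((nat \<Rightarrow> 'a::comm_ring_1 mat) \<Rightarrow> 'a) \<Rightarrow> bool" where
  "line_poly n g \<longleftrightarrow> (\<forall>a b. (\<forall>i. a i \<in> carrier_mat n n) \<longrightarrow> (\<forall>i. b i \<in> carrier_mat n n) \<longrightarrow>
     (\<exists>P. \<forall>t. g (\<lambda>i. a i + t \<cdot>\<^sub>m b i) = poly P t))"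

lemma line_poly_const: "line_poly n (\<lambda>a. c)"
  unfolding line_poly_def by (metis poly_const_conv)

lemma line_poly_entry:
  assumes "r < n" "s < n"
  shows "line_poly n (\<lambda>a. a i $$ (r, s))"
  unfolding line_poly_def
proof (intro allI impI)
  fix a b :: "nat \<Rightarrow> 'a mat"
  assume "\<forall>i. a i \<in> carrier_mat n n" "\<forall>i. b i \<in> carrier_mat n n"
  then have "dim_row (a i) = n" "dim_col (a i) = n" "dim_row (b i) = n" "dim_col (b i) = n" by auto
  then show "\<exists>P. \<forall>t. (a i + t \<cdot>\<^sub>m b i) $$ (r, s) = poly P t"
    using assms by (intro exI[of _ "[:a i $$ (r, s), b i $$ (r, s):]"]) simp
qed

lemma line_poly_mult:
  assumes "line_poly n g" "line_poly n h"
  shows "line_poly n (\<lambda>a. g a * h a)"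
  unfolding line_poly_def
proof (intro allI impI)
  fix a b :: "nat \<Rightarrow> 'a mat"
  assume ab: "\<forall>i. a i \<in> carrier_mat n n" "\<forall>i. b i \<in> carrier_mat n n"
  obtain P Q where "\<And>t. g (\<lambda>i. a i + t \<cdot>\<^sub>m b i) = poly P t" "\<And>t. h (\<lambda>i. a i + t \<cdot>\<^sub>m b i) = poly Q t"
    using assms ab unfolding line_poly_def by meson
  then show "\<exists>P. \<forall>t. g (\<lambda>i. a i + t \<cdot>\<^sub>m b i) * h (\<lambda>i. a i + t \<cdot>\<^sub>m b i) = poly P t"
    by (intro exI[of _ "P * Q"]) simp
qed

lemma line_poly_add:
  assumes "line_poly n g" "line_poly n h"
  shows "line_poly n (\<lambda>a. g a + h a)"
  unfolding line_poly_def
proof (intro allI impI)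
  fix a b :: "nat \<Rightarrow> 'a mat"
  assume ab: "\<forall>i. a i \<in> carrier_mat n n" "\<forall>i. b i \<in> carrier_mat n n"
  obtain P Q where "\<And>t. g (\<lambda>i. a i + t \<cdot>\<^sub>m b i) = poly P t" "\<And>t. h (\<lambda>i. a i + t \<cdot>\<^sub>m b i) = poly Q t"
    using assms ab unfolding line_poly_def by meson
  then show "\<exists>P. \<forall>t. g (\<lambda>i. a i + t \<cdot>\<^sub>m b i) + h (\<lambda>i. a i + t \<cdot>\<^sub>m b i) = poly P t"
    by (intro exI[of _ "P + Q"]) simp
qed

lemma line_poly_diff:
  assumes "line_poly n g" "line_poly n h"
  shows "line_poly n (\<lambda>a. g a - h a)"
  using line_poly_add[OF assms(1) line_poly_mult[OF line_poly_const[of n "-1"] assms(2)]] by simp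

lemma line_poly_sum:
  assumes "\<And>k. k \<in> K \<Longrightarrow> line_poly n (g k)"
  shows "line_poly n (\<lambda>a. \<Sum>k\<in>K. g k a)"
  using assms
  by (induction K rule: infinite_finite_induct) (simp_all add: line_poly_const line_poly_add)

text \<open>On the line from a point \<open>a\<close> good for \<open>K\<close> to a point
  \<open>b\<close> good for the new index, every function is a polynomial in \<open>t\<close>,
  nonzero at \<open>t = 0\<close> or at \<open>t = 1\<close>. Over an infinite field finitely many
  such polynomials have a common non-root.\<close>

lemma line_poly_common_nonzero:
  fixes g :: "'k \<Rightarrow> (nat \<Rightarrow> 'a::field_char_0 mat) \<Rightarrow> 'a"
  assumes "finite K" and "\<And>k. k \<in> K \<Longrightarrow> line_poly n (g k)"
    and "\<And>k. k \<in> K \<Longrightarrow> \<exists>a. (\<forall>i. a i \<in> carrier_mat n n) \<and> g k a \<noteq> 0"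
  shows "\<exists>a. (\<forall>i. a i \<in> carrier_mat n n) \<and> (\<forall>k\<in>K. g k a \<noteq> 0)"
  using assms
proof (induction K rule: finite_induct)
  case empty
  show ?case by (intro exI[of _ "\<lambda>_. 0\<^sub>m n n"]) simp
next
  case (insert l K)
  have "\<exists>a. (\<forall>i. a i \<in> carrier_mat n n) \<and> (\<forall>k\<in>K. g k a \<noteq> 0)"
    by (rule insert.IH) (use insert.prems in simp_all)
  then obtain a where a: "\<forall>i. a i \<in> carrier_mat n n" "\<forall>k\<in>K. g k a \<noteq> 0" by blast
  obtain b where b: "\<forall>i. b i \<in> carrier_mat n n" "g l b \<noteq> 0"
    using insert.prems(2)[of l] by auto
  define c where "c t = (\<lambda>i. a i + t \<cdot>\<^sub>m (b i - a i))" for t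
  have d: "\<forall>i. b i - a i \<in> carrier_mat n n" using a(1) minus_carrier_mat by blast
  have c: "\<forall>i. c t i \<in> carrier_mat n n" for t
    unfolding c_def using a(1) d by (meson add_carrier_mat smult_carrier_mat)
  have c0: "c 0 = a"
  proof
    fix i
    show "c 0 i = a i"
      using a(1)[rule_format, of i] b(1)[rule_format, of i] by (auto simp: c_def intro!: eq_matI)
  qed
  have c1: "c 1 = b"
  proof
    fix i
    show "c 1 i = b i"
      using a(1)[rule_format, of i] b(1)[rule_format, of i] by (auto simp: c_def intro!: eq_matI)
  qed
  have "\<exists>P. \<forall>t. g k (c t) = poly P t" if "k \<in> insert l K" for k
    using insert.prems(1)[OF that, unfolded line_poly_def, rule_format, of a "\<lambda>i. b i - a i"] a(1) d
    unfolding c_def by simp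
  then obtain P where P: "\<And>k t. k \<in> insert l K \<Longrightarrow> g k (c t) = poly (P k) t" by metis
  have nz: "P k \<noteq> 0" if "k \<in> insert l K" for k
  proof
    assume "P k = 0"
    then have "g k (c t) = 0" for t using P[OF that] by simp
    from this[of 0] this[of 1] show False using that a(2) b(2) by (auto simp: c0 c1)
  qed
  have "(\<Prod>k\<in>insert l K. P k) \<noteq> 0" using nz insert.hyps(1) by (simp del: prod.insert)
  then have "finite {t. poly (\<Prod>k\<in>insert l K. P k) t = 0}" by (rule poly_roots_finite)
  then obtain t where "poly (\<Prod>k\<in>insert l K. P k) t \<noteq> 0"
    using ex_new_if_finite[OF infinite_UNIV_char_0] by blast
  then have "poly (P k) t \<noteq> 0" if "k \<in> insert l K" for k
    using that insert.hyps(1) by (auto simp: poly_prod simp del: prod.insert)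
  then show ?case using c P by (intro exI[of _ "c t"]) auto
qed

text \<open>
  The exponent is \<open>(s - r) mod n\<close>, written without truncated subtraction.
\<close>

definition graded_lift :: "nat \<Rightarrow> 'a::comm_ring_1 mat \<Rightarrow> 'a poly mat" where
  "graded_lift n A = mat n n (\<lambda>(r, s). monom (A $$ (r, s)) ((s + (n - r)) mod n))"

text \<open>This is \<open>f\<close> at the lifted matrices. The sum is written out because
  \<open>f\<close> has coefficients in \<open>'a\<close> while the matrices have entries in
  \<open>'a poly\<close>.\<close>

definition graded_eval :: "nat \<Rightarrow> 'a::comm_ring_1 free_algebra \<Rightarrow> (nat \<Rightarrow> 'a mat) \<Rightarrow> 'a poly mat" where
  "graded_eval n f a = mat n n (\<lambda>rs. \<Sum>w\<in>Poly_Mapping.keys f.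
     smult (Poly_Mapping.lookup f w) (word_eval n (\<lambda>i. graded_lift n (a i)) w $$ rs))"

abbreviation graded_coeff ::
  "nat \<Rightarrow> 'a::comm_ring_1 free_algebra \<Rightarrow> (nat \<Rightarrow> 'a mat) \<Rightarrow> nat \<Rightarrow> nat \<Rightarrow> nat \<Rightarrow> 'a" where
  "graded_coeff n f a J r s \<equiv> coeff (graded_eval n f a $$ (r, s)) J"

section \<open>Specialization and support of the graded value\<close>

lemma graded_lift_carrier [simp]: "graded_lift n A \<in> carrier_mat n n"
  by (simp add: graded_lift_def)

lemma graded_lift_index:
  "r < n \<Longrightarrow> s < n \<Longrightarrow> graded_lift n A $$ (r, s) = monom (A $$ (r, s)) ((s + (n - r)) mod n)"
  by (simp add: graded_lift_def)

lemma graded_eval_carrier [simp]: "graded_eval n f a \<in> carrier_mat n n"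
  by (simp add: graded_eval_def)

lemma map_graded_lift_one:
  "A \<in> carrier_mat n n \<Longrightarrow> map_mat (\<lambda>p. poly p 1) (graded_lift n A) = A"
  by (rule eq_matI) (auto simp: graded_lift_def poly_monom)

lemma (in comm_ring_hom) map_word_eval:
  assumes a: "\<forall>i. a i \<in> carrier_mat n n"
  shows "map_mat hom (word_eval n a w) = word_eval n (\<lambda>i. map_mat hom (a i)) w"
proof (induction w)
  case Nil
  show ?case by (simp add: word_eval_def mat_hom_one)
next
  case (Cons i w)
  then show ?case
    using mat_hom_mult[OF a[rule_format, of i] word_eval_carrier[OF a, of w]]
    by (simp add: word_eval_def)
qed

text \<open>Evaluation at \<open>q\<close> is a ring homomorphism and so commutes with products of
  matrices. Every specialization of \<open>graded_eval\<close> is thus a value of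
  \<open>f\<close>.\<close>

lemma map_graded_eval:
  "map_mat (\<lambda>p. poly p q) (graded_eval n f a)
     = free_eval n (\<lambda>i. map_mat (\<lambda>p. poly p q) (graded_lift n (a i))) f"
proof -
  have c: "\<forall>i. graded_lift n (a i) \<in> carrier_mat n n"
    "\<forall>i. map_mat (\<lambda>p. poly p q) (graded_lift n (a i)) \<in> carrier_mat n n" by auto
  note W = comm_ring_hom.map_word_eval[OF poly_hom.comm_ring_hom_axioms c(1), where a1 = q, symmetric]
  show ?thesis
    unfolding free_eval_superset[OF c(2) finite_keys order_refl] W
  proof (rule eq_matI)
    fix r s assume "r < dim_row (mat n n (\<lambda>ij. \<Sum>w\<in>Poly_Mapping.keys f. Poly_Mapping.lookup f w *
        map_mat (\<lambda>p. poly p q) (word_eval n (\<lambda>i. graded_lift n (a i)) w) $$ ij))"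
      "s < dim_col (mat n n (\<lambda>ij. \<Sum>w\<in>Poly_Mapping.keys f. Poly_Mapping.lookup f w *
        map_mat (\<lambda>p. poly p q) (word_eval n (\<lambda>i. graded_lift n (a i)) w) $$ ij))"
    then have rs: "r < n" "s < n" by auto
    have "dim_row (word_eval n (\<lambda>i. graded_lift n (a i)) w) = n"
      "dim_col (word_eval n (\<lambda>i. graded_lift n (a i)) w) = n" for w
      using carrier_matD[OF word_eval_carrier[OF c(1), of w]] by auto
    with rs show "map_mat (\<lambda>p. poly p q) (graded_eval n f a) $$ (r, s) = mat n n (\<lambda>ij. \<Sum>w\<in>Poly_Mapping.keys f. Poly_Mapping.lookup f w *
        map_mat (\<lambda>p. poly p q) (word_eval n (\<lambda>i. graded_lift n (a i)) w) $$ ij) $$ (r, s)"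
      by (simp add: graded_eval_def poly_sum)
  qed (simp_all add: graded_eval_def)
qed

lemma word_eval_Cons_index:
  assumes "\<forall>i. a i \<in> carrier_mat n n" "r < n" "s < n"
  shows "word_eval n a (i # w) $$ (r, s) = (\<Sum>l<n. a i $$ (r, l) * word_eval n a w $$ (l, s))"
  using index_mult_mat_sum[OF assms(1)[rule_format, of i] word_eval_carrier[OF assms(1), of w] assms(2,3)]
  by (simp add: word_eval_def)

lemma coeff_word_eval_graded_lift_Cons:
  assumes "r < n" "s < n"
  shows "coeff (word_eval n (\<lambda>i. graded_lift n (a i)) (i # w) $$ (r, s)) J
    = (\<Sum>l<n. if (l + (n - r)) mod n \<le> J
        then a i $$ (r, l) * coeff (word_eval n (\<lambda>i. graded_lift n (a i)) w $$ (l, s)) (J - (l + (n - r)) mod n)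
        else 0)"
  using assms
  by (subst word_eval_Cons_index) (auto simp: coeff_sum graded_lift_index coeff_monom_mult intro!: sum.cong)

text \<open>A term of the product is a path of indices from \<open>r\<close> to \<open>s\<close>.
  Each of its steps has degree congruent modulo \<open>n\<close> to the increase of the index, so
  the total degree is congruent to \<open>s - r\<close>.\<close>

lemma coeff_word_eval_graded_lift_support:
  assumes "coeff (word_eval n (\<lambda>i. graded_lift n (a i)) w $$ (r, s)) J \<noteq> 0" "r < n" "s < n"
  shows "s = (r + J) mod n"
  using assms
proof (induction w arbitrary: r J)
  case Nil
  then show ?case by (auto simp: word_eval_def coeff_1 split: if_splits)
next
  case (Cons i w)
  let ?d = "\<lambda>l. (l + (n - r)) mod n"
  have "\<exists>l<n. ?d l \<le> J \<and> coeff (word_eval n (\<lambda>i. graded_lift n (a i)) w $$ (l, s)) (J - ?d l) \<noteq> 0"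
  proof (rule ccontr)
    assume "\<not> ?thesis"
    then have "coeff (word_eval n (\<lambda>i. graded_lift n (a i)) (i # w) $$ (r, s)) J = 0"
      unfolding coeff_word_eval_graded_lift_Cons[OF Cons.prems(2,3)] by (intro sum.neutral) auto
    with Cons.prems(1) show False by simp
  qed
  then obtain l where l: "l < n" "?d l \<le> J"
    "coeff (word_eval n (\<lambda>i. graded_lift n (a i)) w $$ (l, s)) (J - ?d l) \<noteq> 0" by blast
  have "s = (l + (J - ?d l)) mod n" by (rule Cons.IH[OF l(3,1) Cons.prems(3)])
  moreover have "l = (r + ?d l) mod n"
    using l(1) Cons.prems(2) by (simp add: mod_add_right_eq add.commute add.left_commute)
  ultimately have "s = ((r + ?d l) mod n + (J - ?d l)) mod n" by simp
  also have "\<dots> = (r + ?d l + (J - ?d l)) mod n" by (rule mod_add_left_eq)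
  also have "r + ?d l + (J - ?d l) = r + J" using l(2) by simp
  finally show ?case .
qed

lemma graded_coeff_support:
  assumes "graded_coeff n f a J r s \<noteq> 0" "r < n" "s < n"
  shows "s = (r + J) mod n"
proof -
  have "graded_coeff n f a J r s = (\<Sum>w\<in>Poly_Mapping.keys f. Poly_Mapping.lookup f w *
      coeff (word_eval n (\<lambda>i. graded_lift n (a i)) w $$ (r, s)) J)"
    using assms(2,3) by (simp add: graded_eval_def coeff_sum)
  then have "\<exists>w. coeff (word_eval n (\<lambda>i. graded_lift n (a i)) w $$ (r, s)) J \<noteq> 0"
    using assms(1) by (metis (mono_tags, lifting) mult_zero_right sum.neutral)
  then show ?thesis using coeff_word_eval_graded_lift_support assms(2,3) by blast
qed

lemma line_poly_coeff_word_eval: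
  assumes "r < n" "s < n"
  shows "line_poly n (\<lambda>a. coeff (word_eval n (\<lambda>i. graded_lift n (a i)) w $$ (r, s)) J)"
  using assms
proof (induction w arbitrary: r J)
  case Nil
  then show ?case by (simp add: word_eval_def line_poly_const)
next
  case (Cons i w)
  show ?case
    unfolding coeff_word_eval_graded_lift_Cons[OF Cons.prems]
  proof (rule line_poly_sum, goal_cases)
    case (1 l)
    then have l: "l < n" by simp
    show ?case
      using line_poly_mult[OF line_poly_entry[OF Cons.prems(1) l, of i]
          Cons.IH[OF l Cons.prems(2), of "J - (l + (n - r)) mod n"]]
      by (cases "(l + (n - r)) mod n \<le> J") (simp_all only: if_True if_False line_poly_const)
  qed
qed

lemma line_poly_graded_coeff:
  assumes "r < n" "s < n"
  shows "line_poly n (\<lambda>a. graded_coeff n f a J r s)"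
proof -
  have "graded_coeff n f a J r s = (\<Sum>w\<in>Poly_Mapping.keys f. Poly_Mapping.lookup f w *
      coeff (word_eval n (\<lambda>i. graded_lift n (a i)) w $$ (r, s)) J)" for a
    using assms by (simp add: graded_eval_def coeff_sum)
  then show ?thesis
    by (simp add: line_poly_sum line_poly_mult line_poly_const line_poly_coeff_word_eval assms)
qed

section \<open>Cyclic symmetry\<close>

lemma bij_betw_rotate:
  fixes n k :: nat
  assumes "n > 0"
  shows "bij_betw (\<lambda>r. (r + k) mod n) {..<n} {..<n}"
proof -
  have "inj_on (\<lambda>r. (r + k) mod n) {..<n}"
  proof (rule inj_onI)
    fix r s assume rs: "r \<in> {..<n}" "s \<in> {..<n}" "(r + k) mod n = (s + k) mod n"
    \<comment> \<open>A natural number congruent to \<open>-k\<close> modulo \<open>n\<close>, which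
      undoes the rotation.\<close>
    define k' where "k' = n * k - k"
    have k': "k + k' = n * k" using assms by (simp add: k'_def)
    have "r = ((r + k) mod n + k') mod n" if "r < n" for r
      using that k' by (simp add: mod_add_left_eq add.assoc)
    then show "r = s" using rs by (metis lessThan_iff)
  qed
  moreover have "(\<lambda>r. (r + k) mod n) ` {..<n} \<subseteq> {..<n}" using assms by auto
  ultimately show ?thesis by (simp add: bij_betw_def endo_inj_surj)
qed

text \<open>For \<open>k\<close> a shift of the indices modulo \<open>n\<close>, this is conjugation
  by a power of the cyclic permutation matrix. It preserves \<open>s - r\<close> modulo
  \<open>n\<close> and hence the grading.\<close>

definition rotate_mat :: "nat \<Rightarrow> nat \<Rightarrow> 'a mat \<Rightarrow> 'a mat" where
  "rotate_mat n k A = mat n n (\<lambda>(r, s). A $$ ((r + k) mod n, (s + k) mod n))"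

lemma rotate_mat_carrier [simp]: "rotate_mat n k A \<in> carrier_mat n n"
  by (simp add: rotate_mat_def)

lemma graded_lift_rotate_mat:
  assumes "r < n" "s < n"
  shows "graded_lift n (rotate_mat n k A) $$ (r, s) = graded_lift n A $$ ((r + k) mod n, (s + k) mod n)"
proof -
  have n: "n > 0" using assms by simp
  \<comment> \<open>Adding \<open>(r + k) mod n\<close> to both exponents gives the same residue,
    and rotation is injective below \<open>n\<close>.\<close>
  have "((s + k) mod n + (n - (r + k) mod n)) mod n = (s + (n - r)) mod n"
  proof -
    let ?x = "((s + k) mod n + (n - (r + k) mod n)) mod n" and ?y = "(s + (n - r)) mod n"
    have "(?x + (r + k) mod n) mod n = (s + k) mod n"
      using mod_less_divisor[OF n, of "r + k"]
      by (simp add: mod_add_left_eq add.assoc)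
    moreover have "(?y + (r + k) mod n) mod n = (s + k) mod n"
    proof -
      have "(?y + (r + k) mod n) mod n = (s + (n - r) + (r + k)) mod n" by (simp add: mod_add_eq)
      also have "s + (n - r) + (r + k) = s + k + n" using assms by simp
      finally show ?thesis by simp
    qed
    ultimately show ?thesis
      using bij_betw_rotate[OF n, of "(r + k) mod n"] mod_less_divisor[OF n]
      unfolding bij_betw_def inj_on_def by (metis lessThan_iff)
  qed
  then show ?thesis using assms n by (simp add: graded_lift_def rotate_mat_def)
qed

lemma word_eval_graded_lift_rotate_mat:
  assumes "r < n" "s < n"
  shows "word_eval n (\<lambda>i. graded_lift n (rotate_mat n k (a i))) w $$ (r, s)
    = word_eval n (\<lambda>i. graded_lift n (a i)) w $$ ((r + k) mod n, (s + k) mod n)"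
  using assms(1)
proof (induction w arbitrary: r)
  case Nil
  have n: "n > 0" using Nil by simp
  have "(r + k) mod n = (s + k) mod n \<longleftrightarrow> r = s"
    using bij_betw_rotate[OF n, of k] Nil assms(2) unfolding bij_betw_def inj_on_def by (metis lessThan_iff)
  then show ?case using Nil assms(2) n by (simp add: word_eval_def)
next
  case (Cons i w)
  have n: "n > 0" using Cons.prems by simp
  let ?\<rho> = "\<lambda>r. (r + k) mod n"
  have \<rho>: "?\<rho> r < n" for r using n by simp
  have "word_eval n (\<lambda>i. graded_lift n (rotate_mat n k (a i))) (i # w) $$ (r, s)
    = (\<Sum>l<n. graded_lift n (a i) $$ (?\<rho> r, ?\<rho> l) * word_eval n (\<lambda>i. graded_lift n (a i)) w $$ (?\<rho> l, ?\<rho> s))"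
    using Cons.prems assms(2)
    by (subst word_eval_Cons_index) (simp_all add: graded_lift_rotate_mat Cons.IH)
  also have "\<dots> = (\<Sum>l<n. graded_lift n (a i) $$ (?\<rho> r, l) * word_eval n (\<lambda>i. graded_lift n (a i)) w $$ (l, ?\<rho> s))"
    by (rule sum.reindex_bij_betw[OF bij_betw_rotate[OF n]])
  also have "\<dots> = word_eval n (\<lambda>i. graded_lift n (a i)) (i # w) $$ (?\<rho> r, ?\<rho> s)"
    by (rule word_eval_Cons_index[symmetric]) (use \<rho> in auto)
  finally show ?case .
qed

text \<open>A nonzero entry, or a difference between two diagonal entries, can thereby be carried
  around the cycle by changing the arguments.\<close>

lemma graded_coeff_rotate_mat:
  assumes "r < n" "s < n"
  shows "graded_coeff n f (\<lambda>i. rotate_mat n k (a i)) J r s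
    = graded_coeff n f a J ((r + k) mod n) ((s + k) mod n)"
proof -
  have "(r + k) mod n < n" "(s + k) mod n < n" using assms by auto
  then show ?thesis using assms by (simp add: graded_eval_def word_eval_graded_lift_rotate_mat)
qed

section \<open>A value with small eigenvalue multiplicities\<close>

lemma root_of_unity_nontrivial_power:
  assumes "n > 0" "J mod n \<noteq> 0"
  obtains \<omega> :: "'a::{alg_closed_field, field_char_0}" where "\<omega> ^ n = 1" "\<omega> ^ J \<noteq> 1"
proof -
  \<comment> \<open>Dividing by the gcd leaves coprime \<open>m > 1\<close> and \<open>j\<close>. An
    \<open>m\<close>-th root of unity \<open>\<eta> \<noteq> 1\<close> then has
    \<open>\<eta> ^ j \<noteq> 1\<close>, and a \<open>d\<close>-th root of \<open>\<eta>\<close>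
    serves as \<open>\<omega>\<close>.\<close>
  define d where "d = gcd n J"
  have d0: "d > 0" using assms by (simp add: d_def)
  define m j where "m = n div d" and "j = J div d"
  have m: "n = d * m" and j: "J = d * j" by (simp_all add: d_def m_def j_def)
  have cop: "coprime m j"
    unfolding m_def j_def d_def by (rule div_gcd_coprime) (use assms(1) in simp)
  have "m > 1"
  proof (rule ccontr)
    assume "\<not> m > 1"
    then have "m = 1" using m assms(1) by (cases m) auto
    then show False using m j assms(2) by simp
  qed
  \<comment> \<open>A zero of the geometric sum is an \<open>m\<close>-th root of unity; it differs
    from 1, where the sum is \<open>m\<close>, nonzero in characteristic 0.\<close>
  obtain \<eta> :: 'a where \<eta>: "(\<Sum>k\<le>m - 1. 1 * \<eta> ^ k) = 0"
    using alg_closed[of "m - 1" "\<lambda>_. 1::'a"] \<open>m > 1\<close> by auto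
  have \<eta>m: "\<eta> ^ m = 1"
    using power_diff_1_eq[of \<eta> m] \<eta> \<open>m > 1\<close> by (simp add: lessThan_Suc_atMost[symmetric])
  have \<eta>1: "\<eta> \<noteq> 1"
    using \<eta> \<open>m > 1\<close> by (auto simp: of_nat_diff)
  have "\<eta> ^ j \<noteq> 1"
  proof
    assume \<eta>j: "\<eta> ^ j = 1"
    \<comment> \<open>By Bezout, \<open>\<eta> ^ m = 1\<close> and \<open>\<eta> ^ j = 1\<close>
      together would give \<open>\<eta> = 1\<close>.\<close>
    obtain x y where "m * x = j * y + gcd m j"
      using bezout_nat[of m j] \<open>m > 1\<close> by auto
    then have "m * x = j * y + 1" using cop by simp
    then have "\<eta> ^ (m * x) = \<eta> ^ (j * y) * \<eta>" by simp
    then show False using \<eta>m \<eta>j \<eta>1 by (simp add: power_mult)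
  qed
  moreover obtain \<omega> where \<omega>: "\<omega> ^ d = \<eta>" using nth_root_exists[OF d0] by blast
  ultimately have "\<omega> ^ n = 1" "\<omega> ^ J \<noteq> 1"
    using \<eta>m by (simp_all add: m j power_mult)
  then show ?thesis by (rule that)
qed

lemma count_list_map_mult:
  fixes c :: "'a::field"
  assumes "c \<noteq> 0"
  shows "count_list (map ((*) c) es) (c * x) = count_list es x"
  using assms by (induction es) auto

lemma count_list_add_le:
  "x \<noteq> y \<Longrightarrow> count_list es x + count_list es y \<le> length es"
  by (induction es) auto

text \<open>Scaling by \<open>\<zeta>\<close> preserves the multiset of eigenvalues, so
  \<open>x\<close> and \<open>\<zeta> * x\<close> occur equally often. For
  \<open>x \<noteq> 0\<close> they are distinct and share \<open>n\<close> places; 0 is no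
  eigenvalue since \<open>X\<close> is invertible.\<close>

lemma order_char_poly_self_similar:
  fixes X :: "'a::alg_closed_field mat"
  assumes X: "X \<in> carrier_mat n n" and det: "det X \<noteq> 0"
    and z: "\<zeta> \<noteq> 0" "\<zeta> \<noteq> 1" and sim: "similar_mat X (\<zeta> \<cdot>\<^sub>m X)"
  shows "order x (char_poly X) \<le> n div 2"
proof -
  obtain es where es: "char_poly X = (\<Prod>e\<leftarrow>es. [:- e, 1:])" "length es = n"
    by (rule char_poly_linear_factors[OF X])
  obtain B where B: "similar_mat X B" "upper_triangular B" "diag_mat B = es"
    using similar_mat_upper_triangular[OF X es(1)] by blast
  have Bc: "B \<in> carrier_mat n n" using similar_matD[OF B(1)] X by auto
  have "upper_triangular (\<zeta> \<cdot>\<^sub>m B)"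
    using B(2) Bc by (intro upper_triangularI) (auto simp: upper_triangular_def)
  moreover have "\<zeta> \<cdot>\<^sub>m B \<in> carrier_mat n n" using Bc by simp
  moreover have "diag_mat (\<zeta> \<cdot>\<^sub>m B) = map ((*) \<zeta>) es"
    using Bc by (auto simp: diag_mat_def simp flip: B(3))
  ultimately have "char_poly (\<zeta> \<cdot>\<^sub>m B) = (\<Prod>e\<leftarrow>map ((*) \<zeta>) es. [:- e, 1:])"
    using char_poly_upper_triangular by metis
  moreover have "similar_mat X (\<zeta> \<cdot>\<^sub>m B)"
    by (rule similar_mat_trans[OF sim similar_mat_smult[OF B(1)]])
  ultimately have "char_poly X = (\<Prod>e\<leftarrow>map ((*) \<zeta>) es. [:- e, 1:])"
    using char_poly_similar by metis
  then have "order y (char_poly X) = count_list (map ((*) \<zeta>) es) y" for y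
    by (simp only: order_prod_linear_factors)
  then have ord: "count_list es y = count_list (map ((*) \<zeta>) es) y" for y
    by (simp only: es(1) order_prod_linear_factors)
  show ?thesis
  proof (cases "x = 0")
    case True
    have "poly (char_poly X) 0 \<noteq> 0"
    proof
      assume "poly (char_poly X) 0 = 0"
      then have "eigenvalue X 0" using eigenvalue_root_char_poly[OF X] by simp
      then obtain v where v: "v \<in> carrier_vec n" "v \<noteq> 0\<^sub>v n" "X *\<^sub>v v = 0 \<cdot>\<^sub>v v"
        using X by (auto simp: eigenvalue_def eigenvector_def)
      moreover have "0 \<cdot>\<^sub>v v = 0\<^sub>v n" using v(1) by auto
      ultimately show False using det det_0_iff_vec_prod_zero_field[OF X] by auto
    qed
    then show ?thesis using True by (simp add: order_0I)
  next
    case False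
    have "count_list es (\<zeta> * x) = count_list es x"
      using ord[of "\<zeta> * x"] count_list_map_mult[OF z(1)] by simp
    moreover have "x \<noteq> \<zeta> * x" using False z by simp
    ultimately have "2 * count_list es x \<le> n"
      using count_list_add_le[of x "\<zeta> * x" es] es(2) by simp
    then show ?thesis by (simp add: es(1) order_prod_linear_factors)
  qed
qed

text \<open>The diagonal matrix \<open>D\<close> of powers of \<open>\<omega>\<close> intertwines
  \<open>X\<close> with \<open>\<omega> ^ J \<cdot>\<^sub>m X\<close>, since \<open>s\<close> is
  congruent to \<open>r + J\<close> on the support and \<open>\<omega> ^ n = 1\<close>. Being a
  permutation matrix with nonzero weights, \<open>X\<close> is invertible.\<close>

lemma order_char_poly_shifted_diag:
  fixes X :: "'a::{alg_closed_field, field_char_0} mat"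
  assumes X: "X \<in> carrier_mat n n" and n: "n > 0" and J: "J mod n \<noteq> 0"
    and supp: "\<And>r s. r < n \<Longrightarrow> s < n \<Longrightarrow> X $$ (r, s) \<noteq> 0 \<longleftrightarrow> s = (r + J) mod n"
  shows "order x (char_poly X) \<le> n div 2"
proof -
  obtain \<omega> :: 'a where \<omega>: "\<omega> ^ n = 1" "\<omega> ^ J \<noteq> 1"
    by (rule root_of_unity_nontrivial_power[OF n J])
  have \<omega>0: "\<omega> \<noteq> 0" using \<omega>(1) n by (auto simp: power_0_left)
  have \<omega>mod: "\<omega> ^ (k mod n) = \<omega> ^ k" for k
  proof -
    have "\<omega> ^ k = \<omega> ^ (n * (k div n) + k mod n)" by simp
    also have "\<dots> = \<omega> ^ (k mod n)" by (simp only: power_add power_mult \<omega>(1) power_one mult_1)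
    finally show ?thesis ..
  qed
  define D where "D = mat n n (\<lambda>(r, s). if r = s then \<omega> ^ r else 0)"
  have D: "D \<in> carrier_mat n n" by (simp add: D_def)
  have "det D \<noteq> 0"
  proof (rule det_nonzeroI[OF D])
    fix y assume y: "\<And>i. i < n \<Longrightarrow> (\<Sum>j<n. D $$ (i, j) * y j) = 0"
    have "y i = 0" if "i < n" for i
    proof -
      have "(\<Sum>j<n. D $$ (i, j) * y j) = (\<Sum>j<n. if j = i then \<omega> ^ i * y i else 0)"
        by (rule sum.cong) (use that in \<open>auto simp: D_def\<close>)
      then show ?thesis using y[OF that] that \<omega>0 by simp
    qed
    then show "\<forall>j<n. y j = 0" by blast
  qed
  moreover have "X * D = D * (\<omega> ^ J \<cdot>\<^sub>m X)"
  proof (rule eq_matI)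
    fix r s assume "r < dim_row (D * (\<omega> ^ J \<cdot>\<^sub>m X))" "s < dim_col (D * (\<omega> ^ J \<cdot>\<^sub>m X))"
    then have rs: "r < n" "s < n" using D X by auto
    have "(X * D) $$ (r, s) = (\<Sum>l<n. if l = s then X $$ (r, s) * \<omega> ^ s else 0)"
      unfolding index_mult_mat_sum[OF X D rs] by (rule sum.cong) (use rs in \<open>auto simp: D_def\<close>)
    also have "\<dots> = X $$ (r, s) * \<omega> ^ s" using rs by simp
    also have "\<dots> = \<omega> ^ r * (\<omega> ^ J * X $$ (r, s))"
      using supp[OF rs] \<omega>mod[of "r + J"] by (cases "X $$ (r, s) = 0") (auto simp: power_add)
    also have "\<dots> = (\<Sum>l<n. if l = r then \<omega> ^ r * (\<omega> ^ J * X $$ (r, s)) else 0)" using rs by simp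
    also have "\<dots> = (\<Sum>l<n. D $$ (r, l) * (\<omega> ^ J \<cdot>\<^sub>m X) $$ (l, s))"
      by (rule sum.cong) (use rs X in \<open>auto simp: D_def\<close>)
    also have "\<dots> = (D * (\<omega> ^ J \<cdot>\<^sub>m X)) $$ (r, s)"
      by (rule index_mult_mat_sum[symmetric]) (use D X rs in auto)
    finally show "(X * D) $$ (r, s) = (D * (\<omega> ^ J \<cdot>\<^sub>m X)) $$ (r, s)" .
  qed (use D X in auto)
  ultimately have sim: "similar_mat X (\<omega> ^ J \<cdot>\<^sub>m X)"
    using similar_mat_intertwine[OF X _ D] X by simp
  have detX: "det X \<noteq> 0"
  proof (rule det_nonzeroI[OF X])
    fix y assume y: "\<And>i. i < n \<Longrightarrow> (\<Sum>j<n. X $$ (i, j) * y j) = 0"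
    have yJ: "y ((i + J) mod n) = 0" if "i < n" for i
    proof -
      have "(\<Sum>j<n. X $$ (i, j) * y j)
          = (\<Sum>j<n. if j = (i + J) mod n then X $$ (i, (i + J) mod n) * y ((i + J) mod n) else 0)"
        by (rule sum.cong) (use that supp in auto)
      then show ?thesis using y[OF that] that n supp[OF that, of "(i + J) mod n"] by simp
    qed
    show "\<forall>j<n. y j = 0"
    proof (intro allI impI)
      fix j assume "j < n"
      then have "j \<in> (\<lambda>i. (i + J) mod n) ` {..<n}"
        using bij_betw_imp_surj_on[OF bij_betw_rotate[OF n, of J]] by simp
      then obtain i where i: "i < n" "j = (i + J) mod n" by blast
      show "y j = 0" unfolding i(2) by (rule yJ[OF i(1)])
    qed
  qed
  show ?thesis
    using order_char_poly_self_similar[OF X detX _ \<omega>(2) sim] \<omega>0 by simp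
qed

lemma order_char_poly_diag:
  fixes X :: "'a::field mat"
  assumes X: "X \<in> carrier_mat n n" and diag: "\<And>r s. r < n \<Longrightarrow> s < n \<Longrightarrow> r \<noteq> s \<Longrightarrow> X $$ (r, s) = 0"
  shows "order x (char_poly X) = card {r. r < n \<and> X $$ (r, r) = x}"
proof -
  have "upper_triangular X" using X diag by (intro upper_triangularI) auto
  then have "order x (char_poly X) = count_list (diag_mat X) x"
    using char_poly_upper_triangular[OF X] by (simp add: order_prod_linear_factors)
  also have "\<dots> = card {r. r < n \<and> X $$ (r, r) = x}"
    using X unfolding count_list_eq_length_filter length_filter_conv_card
    by (intro arg_cong[of _ _ card]) (auto simp: diag_mat_def)
  finally show ?thesis .
qed

text \<open>Generic arguments satisfy finitely many nonvanishing conditions at once, and rotation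
  supplies enough of them. If \<open>n\<close> does not divide \<open>J\<close>, one nonzero entry
  spreads along the whole shifted diagonal. Otherwise one pair of differing diagonal entries yields
  such a pair at every position, with the same shift.\<close>

lemma graded_coeff_generic_multiplicity:
  fixes f :: "'a::{alg_closed_field, field_char_0} free_algebra"
  assumes n: "n > 0" and a0: "\<forall>i. a0 i \<in> carrier_mat n n"
    and nonscalar: "(\<exists>r<n. \<exists>s<n. r \<noteq> s \<and> graded_coeff n f a0 J r s \<noteq> 0) \<or>
      (\<exists>r<n. \<exists>s<n. graded_coeff n f a0 J r r \<noteq> graded_coeff n f a0 J s s)"
  obtains a where "\<forall>i. a i \<in> carrier_mat n n"
    "\<And>x. order x (char_poly (mat n n (\<lambda>(r, s). graded_coeff n f a J r s))) \<le> n div 2"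
proof (cases "J mod n = 0")
  case False
  let ?\<sigma> = "\<lambda>r. (r + J) mod n"
  have "\<exists>r<n. graded_coeff n f a0 J r (?\<sigma> r) \<noteq> 0"
  proof (rule ccontr)
    assume "\<not> ?thesis"
    then have zero: "graded_coeff n f a0 J r s = 0" if "r < n" "s < n" for r s
      using that graded_coeff_support[OF _ that] by metis
    from nonscalar show False
    proof (elim disjE exE conjE)
      fix r s assume "r < n" "s < n" "graded_coeff n f a0 J r s \<noteq> 0"
      then show False using zero by blast
    next
      fix r s assume "r < n" "s < n" "graded_coeff n f a0 J r r \<noteq> graded_coeff n f a0 J s s"
      then show False using zero[of r r] zero[of s s] by simp
    qed
  qed
  then obtain r0 where r0: "r0 < n" "graded_coeff n f a0 J r0 (?\<sigma> r0) \<noteq> 0" by blast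
  have "\<exists>a. (\<forall>i. a i \<in> carrier_mat n n) \<and> (\<forall>r\<in>{..<n}. graded_coeff n f a J r (?\<sigma> r) \<noteq> 0)"
  proof (rule line_poly_common_nonzero)
    fix r assume "r \<in> {..<n}"
    then have r: "r < n" by simp
    show "line_poly n (\<lambda>a. graded_coeff n f a J r (?\<sigma> r))"
      by (rule line_poly_graded_coeff) (use r n in auto)
    \<comment> \<open>Rotation by \<open>r0 - r\<close> modulo \<open>n\<close> carries
      \<open>r\<close> to \<open>r0\<close> and also \<open>r + J\<close> to
      \<open>r0 + J\<close>.\<close>
    define k where "k = r0 + (n - r)"
    have "(r + k) mod n = r0" using r r0(1) by (simp add: k_def)
    moreover from this have "(?\<sigma> r + k) mod n = ?\<sigma> r0"
      by (metis add.assoc add.commute mod_add_left_eq)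
    ultimately have "graded_coeff n f (\<lambda>i. rotate_mat n k (a0 i)) J r (?\<sigma> r) \<noteq> 0"
      using r0(2) graded_coeff_rotate_mat[OF r, of "?\<sigma> r" f k a0 J] n by simp
    then show "\<exists>a. (\<forall>i. a i \<in> carrier_mat n n) \<and> graded_coeff n f a J r (?\<sigma> r) \<noteq> 0"
      by (intro exI[of _ "\<lambda>i. rotate_mat n k (a0 i)"]) simp
  qed simp
  then obtain a where a: "\<forall>i. a i \<in> carrier_mat n n" "\<And>r. r < n \<Longrightarrow> graded_coeff n f a J r (?\<sigma> r) \<noteq> 0"
    by blast
  have "order x (char_poly (mat n n (\<lambda>(r, s). graded_coeff n f a J r s))) \<le> n div 2" for x
    by (rule order_char_poly_shifted_diag[OF _ n False]) (use a(2) graded_coeff_support in auto)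
  then show ?thesis by (rule that[OF a(1)])
next
  case True
  have supp: "graded_coeff n f a J r s = 0" if "r < n" "s < n" "r \<noteq> s" for a r s
  proof (rule ccontr)
    assume "graded_coeff n f a J r s \<noteq> 0"
    from graded_coeff_support[OF this that(1,2)] have "s = (r + J mod n) mod n" by (simp add: mod_add_right_eq)
    then show False using True that by simp
  qed
  \<comment> \<open>Equality for all arguments, unlike equality for a single choice of them, is
    invariant under rotation.\<close>
  define E where "E r s \<longleftrightarrow> (\<forall>a. (\<forall>i. a i \<in> carrier_mat n n) \<longrightarrow>
    graded_coeff n f a J r r = graded_coeff n f a J s s)" for r s
  have E_trans: "E r t" if "E r s" "E s t" for r s t using that by (simp add: E_def)
  have E_sym: "E s r" if "E r s" for r s using that by (simp add: E_def)
  have E_shift: "E ((r + k) mod n) ((s + k) mod n)" if "r < n" "s < n" "E r s" for r s k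
    unfolding E_def
  proof (intro allI impI)
    fix a :: "nat \<Rightarrow> 'a mat"
    have "graded_coeff n f (\<lambda>i. rotate_mat n k (a i)) J r r = graded_coeff n f (\<lambda>i. rotate_mat n k (a i)) J s s"
      using that(3) by (simp add: E_def)
    then show "graded_coeff n f a J ((r + k) mod n) ((r + k) mod n)
        = graded_coeff n f a J ((s + k) mod n) ((s + k) mod n)"
      using that by (simp add: graded_coeff_rotate_mat)
  qed
  obtain r1 s1 where rs1: "r1 < n" "s1 < n" "\<not> E r1 s1"
  proof -
    have "\<not> (\<exists>r<n. \<exists>s<n. r \<noteq> s \<and> graded_coeff n f a0 J r s \<noteq> 0)" using supp by blast
    then obtain r s where "r < n" "s < n" "graded_coeff n f a0 J r r \<noteq> graded_coeff n f a0 J s s"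
      using nonscalar by blast
    then show ?thesis using that a0 unfolding E_def by blast
  qed
  \<comment> \<open>The difference of an inequivalent pair modulo \<open>n\<close>. By rotation
    invariance no position is equivalent to its shift by \<open>k\<close>.\<close>
  define k where "k = s1 + (n - r1)"
  have not_E_shift: "\<not> E r ((r + k) mod n)" if r: "r < n" for r
  proof
    assume e: "E r ((r + k) mod n)"
    let ?k = "r1 + (n - r)"
    have "(r + ?k) mod n = r1" using r rs1 by simp
    moreover have "((r + k) mod n + ?k) mod n = s1"
    proof -
      have "((r + k) mod n + ?k) mod n = (r + k + ?k) mod n" by (rule mod_add_left_eq)
      also have "r + k + ?k = s1 + n + n" using r rs1 by (simp add: k_def)
      finally show ?thesis using rs1(2) by simp
    qed
    ultimately show False using E_shift[OF r _ e, of ?k] n rs1(3) by simp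
  qed
  define K where "K = {(r, s). r < n \<and> s < n \<and> \<not> E r s}"
  have "finite K" by (rule finite_subset[of _ "{..<n} \<times> {..<n}"]) (auto simp: K_def)
  then have "\<exists>a. (\<forall>i. a i \<in> carrier_mat n n) \<and>
    (\<forall>rs\<in>K. graded_coeff n f a J (fst rs) (fst rs) - graded_coeff n f a J (snd rs) (snd rs) \<noteq> 0)"
  proof (rule line_poly_common_nonzero)
    fix rs assume "rs \<in> K"
    then have rs: "fst rs < n" "snd rs < n" "\<not> E (fst rs) (snd rs)" by (auto simp: K_def)
    show "line_poly n (\<lambda>a. graded_coeff n f a J (fst rs) (fst rs) - graded_coeff n f a J (snd rs) (snd rs))"
      by (intro line_poly_diff line_poly_graded_coeff rs)
    show "\<exists>a. (\<forall>i. a i \<in> carrier_mat n n) \<and>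
        graded_coeff n f a J (fst rs) (fst rs) - graded_coeff n f a J (snd rs) (snd rs) \<noteq> 0"
      using rs(3) by (auto simp: E_def)
  qed
  then obtain a where a: "\<forall>i. a i \<in> carrier_mat n n" and K: "\<And>rs. rs \<in> K \<Longrightarrow>
      graded_coeff n f a J (fst rs) (fst rs) - graded_coeff n f a J (snd rs) (snd rs) \<noteq> 0" by blast
  \<comment> \<open>For the chosen arguments diagonal entries coincide only if they do so for all
    arguments.\<close>
  have gen: "E r s" if "r < n" "s < n" "graded_coeff n f a J r r = graded_coeff n f a J s s" for r s
    using K[of "(r, s)"] that by (auto simp: K_def)
  let ?X = "mat n n (\<lambda>(r, s). graded_coeff n f a J r s)"
  have "order x (char_poly ?X) \<le> n div 2" for x
  proof -
    define C where "C = {r. r < n \<and> graded_coeff n f a J r r = x}"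
    have ord: "order x (char_poly ?X) = card C"
      using order_char_poly_diag[of ?X n x] supp by (simp add: C_def cong: conj_cong)
    have C: "C \<subseteq> {..<n}" by (auto simp: C_def)
    let ?\<phi> = "\<lambda>r. (r + k) mod n"
    have \<phi>: "bij_betw ?\<phi> {..<n} {..<n}" by (rule bij_betw_rotate[OF n])
    \<comment> \<open>A class of equal entries and its shift by \<open>k\<close> are disjoint and
      equally large, so twice its size is at most \<open>n\<close>.\<close>
    have "?\<phi> r \<notin> C" if "r \<in> C" for r
    proof
      assume "?\<phi> r \<in> C"
      then have "E r (?\<phi> r)" using that gen by (auto simp: C_def)
      then show False using not_E_shift that by (auto simp: C_def)
    qed
    then have disj: "C \<inter> ?\<phi> ` C = {}" by auto
    have \<phi>C: "?\<phi> ` C \<subseteq> {..<n}" "card (?\<phi> ` C) = card C"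
      using \<phi> C n card_image[of ?\<phi> C] inj_on_subset[of ?\<phi> "{..<n}" C] by (auto simp: bij_betw_def)
    have "card C + card (?\<phi> ` C) = card (C \<union> ?\<phi> ` C)"
      using card_Un_disjoint[OF _ _ disj] finite_subset[OF C] by simp
    also have "\<dots> \<le> n" using card_mono[of "{..<n}" "C \<union> ?\<phi> ` C"] C \<phi>C(1) by simp
    finally show ?thesis using \<phi>C(2) ord by simp
  qed
  then show ?thesis by (rule that[OF a])
qed

lemma similar_mat_affine:
  fixes X B :: "'a::field mat"
  assumes sim: "similar_mat X B" and X: "X \<in> carrier_mat n n"
  shows "similar_mat (c \<cdot>\<^sub>m 1\<^sub>m n + k \<cdot>\<^sub>m X) (c \<cdot>\<^sub>m 1\<^sub>m n + k \<cdot>\<^sub>m B)"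
proof -
  obtain m P Q where PQ: "{X, B, P, Q} \<subseteq> carrier_mat m m" "P * Q = 1\<^sub>m m" "Q * P = 1\<^sub>m m" "X = P * B * Q"
    using similar_matD[OF sim] by blast
  have [simp]: "m = n" using PQ(1) X by auto
  have c: "B \<in> carrier_mat n n" "P \<in> carrier_mat n n" "Q \<in> carrier_mat n n" using PQ by auto
  have 1: "P * (c \<cdot>\<^sub>m 1\<^sub>m n + k \<cdot>\<^sub>m B) = c \<cdot>\<^sub>m P + k \<cdot>\<^sub>m (P * B)"
    using c by (simp add: mult_add_distrib_mat[of _ n n _ n] mult_smult_distrib[of _ n n _ n])
  have 2: "(c \<cdot>\<^sub>m P + k \<cdot>\<^sub>m (P * B)) * Q = c \<cdot>\<^sub>m (P * Q) + k \<cdot>\<^sub>m (P * B * Q)"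
    using c by (simp add: add_mult_distrib_mat[of _ n n _ _ n] mult_smult_assoc_mat[of _ n n _ n])
  show ?thesis
    by (rule similar_matI[of _ _ P Q n]) (use PQ c X 1 2 in auto)
qed

section \<open>The lowest nonscalar coefficient\<close>

lemma poly_cutoff_shift:
  fixes p :: "'a::comm_ring_1 poly"
  shows "p = poly_cutoff J p + monom 1 J * poly_shift J p"
  by (rule poly_eqI) (auto simp: coeff_poly_cutoff coeff_poly_shift coeff_monom_mult)

text \<open>If all coefficients were scalar, so would be \<open>graded_eval\<close> and its
  specialization at \<open>q = 1\<close>, which is the given value; but scalar matrices are
  central.\<close>

lemma noncentral_value_nonscalar_coeff:
  fixes f :: "'a::field free_algebra"
  assumes a: "\<forall>i. a i \<in> carrier_mat n n" and "free_eval n a f \<notin> mat_center n"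
  shows "\<exists>J. (\<exists>r<n. \<exists>s<n. r \<noteq> s \<and> graded_coeff n f a J r s \<noteq> 0) \<or>
      (\<exists>r<n. \<exists>s<n. graded_coeff n f a J r r \<noteq> graded_coeff n f a J s s)"
proof (rule ccontr)
  assume no: "\<not> ?thesis"
  let ?W = "graded_eval n f a"
  have off: "?W $$ (r, s) = 0" if "r < n" "s < n" "r \<noteq> s" for r s
  proof (rule poly_eqI)
    fix J
    show "coeff (?W $$ (r, s)) J = coeff 0 J" using no \<open>r < n\<close> \<open>s < n\<close> \<open>r \<noteq> s\<close> by auto
  qed
  have diag: "?W $$ (r, r) = ?W $$ (s, s)" if "r < n" "s < n" for r s
    using no that by (intro poly_eqI) blast
  have "(\<lambda>i. map_mat (\<lambda>p. poly p 1) (graded_lift n (a i))) = a"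
    using a by (intro ext map_graded_lift_one) auto
  then have X: "free_eval n a f = map_mat (\<lambda>p. poly p 1) ?W"
    by (simp add: map_graded_eval)
  have "free_eval n a f = poly (?W $$ (0, 0)) 1 \<cdot>\<^sub>m 1\<^sub>m n"
  proof (rule eq_matI)
    fix r s assume "r < dim_row (poly (?W $$ (0, 0)) 1 \<cdot>\<^sub>m 1\<^sub>m n)" "s < dim_col (poly (?W $$ (0, 0)) 1 \<cdot>\<^sub>m 1\<^sub>m n)"
    then have rs: "r < n" "s < n" by auto
    have W: "dim_row ?W = n" "dim_col ?W = n" by (simp_all add: graded_eval_def)
    show "free_eval n a f $$ (r, s) = (poly (?W $$ (0, 0)) 1 \<cdot>\<^sub>m 1\<^sub>m n) $$ (r, s)"
      using rs W off[OF rs] diag[OF rs(1), of 0] unfolding X by (cases "r = s") auto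
  qed (simp_all add: X graded_eval_def)
  moreover have "c \<cdot>\<^sub>m 1\<^sub>m n \<in> mat_center n" for c :: 'a
    by (auto simp: mat_center_def mult_smult_distrib[of _ n n _ n] mult_smult_assoc_mat[of _ n n _ n])
  ultimately show False using assms(2) by simp
qed

text \<open>Below degree \<open>J\<close> the graded value is scalar, so its specialization at
  \<open>q\<close> is a scalar matrix plus \<open>q ^ J\<close> times that of \<open>M\<close>. At
  0, \<open>M\<close> is the generic coefficient with small multiplicities, and openness moves this
  property to some \<open>q \<noteq> 0\<close>.\<close>

lemma poly_image_distinct_halves:
  fixes f :: "'a::{alg_closed_field, field_char_0} free_algebra"
  assumes n: "n > 0" and "\<not> poly_image n f \<subseteq> mat_center n"
  obtains B where "B \<in> poly_image n f" "upper_triangular B"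
    "\<And>i. i < n div 2 \<Longrightarrow> B $$ (i, i) \<noteq> B $$ (n div 2 + i, n div 2 + i)"
proof -
  define NS where "NS a J \<longleftrightarrow> (\<exists>r<n. \<exists>s<n. r \<noteq> s \<and> graded_coeff n f a J r s \<noteq> 0) \<or>
      (\<exists>r<n. \<exists>s<n. graded_coeff n f a J r r \<noteq> graded_coeff n f a J s s)" for a J
  obtain a1 where a1: "\<forall>i. a1 i \<in> carrier_mat n n" "free_eval n a1 f \<notin> mat_center n"
    using assms(2) by (auto simp: poly_image_def)
  obtain J1 where "NS a1 J1"
    unfolding NS_def using noncentral_value_nonscalar_coeff[OF a1] by blast
  \<comment> \<open>The minimum is over all arguments, so the coefficients below \<open>J\<close>
    remain scalar when \<open>a0\<close> is replaced by the generic \<open>a\<close>.\<close>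
  define J where "J = (LEAST J. \<exists>a. (\<forall>i. a i \<in> carrier_mat n n) \<and> NS a J)"
  have "\<exists>a. (\<forall>i. a i \<in> carrier_mat n n) \<and> NS a J"
    unfolding J_def by (rule LeastI[of _ J1]) (use a1 \<open>NS a1 J1\<close> in blast)
  then obtain a0 where a0: "\<forall>i. a0 i \<in> carrier_mat n n" "NS a0 J" by blast
  have least: "\<not> NS a j" if "j < J" "\<forall>i. a i \<in> carrier_mat n n" for a j
    using not_less_Least[of j "\<lambda>J. \<exists>a. (\<forall>i. a i \<in> carrier_mat n n) \<and> NS a J"] that
    by (auto simp: J_def)
  obtain a where a: "\<forall>i. a i \<in> carrier_mat n n"
    and mult: "\<And>x. order x (char_poly (mat n n (\<lambda>(r, s). graded_coeff n f a J r s))) \<le> n div 2"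
    by (rule graded_coeff_generic_multiplicity[OF n a0(1) a0(2)[unfolded NS_def]]) (rule that)
  let ?W = "graded_eval n f a"
  define M where "M = mat n n (\<lambda>rs. poly_shift J (?W $$ rs))"
  have M: "M \<in> carrier_mat n n" by (simp add: M_def)
  have M0: "map_mat (\<lambda>p. poly p 0) M = mat n n (\<lambda>(r, s). graded_coeff n f a J r s)"
    by (rule eq_matI) (auto simp: M_def poly_0_coeff_0 coeff_poly_shift)
  obtain q where q: "q \<noteq> 0" "\<And>x. order x (char_poly (map_mat (\<lambda>p. poly p q) M)) \<le> n div 2"
    by (rule char_poly_order_open[OF M n, of "n div 2"]) (use mult M0 in auto)
  let ?Mq = "map_mat (\<lambda>p. poly p q) M"
  have Mq: "?Mq \<in> carrier_mat n n" using M by simp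
  obtain B where B: "similar_mat ?Mq B" "B \<in> carrier_mat n n" "upper_triangular B"
    "\<And>i. i < n div 2 \<Longrightarrow> B $$ (i, i) \<noteq> B $$ (n div 2 + i, n div 2 + i)"
    by (rule similar_mat_distinct_halves[OF Mq q(2)]) (rule that)
  \<comment> \<open>\<open>c\<close> is the common scalar from the terms below degree
    \<open>J\<close>. Adding it and scaling by \<open>q ^ J \<noteq> 0\<close> preserve
    triangularity and the differing halves of the diagonal.\<close>
  define c where "c = poly (poly_cutoff J (?W $$ (0, 0))) q"
  define B' where "B' = c \<cdot>\<^sub>m 1\<^sub>m n + q ^ J \<cdot>\<^sub>m B"
  have cut: "poly_cutoff J (?W $$ (r, s)) = (if r = s then poly_cutoff J (?W $$ (0, 0)) else 0)"
    if "r < n" "s < n" for r s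
  proof (rule poly_eqI)
    fix j
    have "graded_coeff n f a j r s = (if r = s then graded_coeff n f a j 0 0 else 0)" if "j < J"
    proof (cases "r = s")
      case True
      have "graded_coeff n f a j r r = graded_coeff n f a j 0 0"
        using least[OF that a] \<open>r < n\<close> n unfolding NS_def by blast
      then show ?thesis using True by simp
    next
      case False
      have "graded_coeff n f a j r s = 0"
        using least[OF that a] \<open>r < n\<close> \<open>s < n\<close> False unfolding NS_def by blast
      then show ?thesis using False by simp
    qed
    then show "coeff (poly_cutoff J (?W $$ (r, s))) j
        = coeff (if r = s then poly_cutoff J (?W $$ (0, 0)) else 0) j"
      by (auto simp: coeff_poly_cutoff)
  qed
  have "map_mat (\<lambda>p. poly p q) ?W = c \<cdot>\<^sub>m 1\<^sub>m n + q ^ J \<cdot>\<^sub>m ?Mq"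
  proof (rule eq_matI)
    fix r s assume "r < dim_row (c \<cdot>\<^sub>m 1\<^sub>m n + q ^ J \<cdot>\<^sub>m ?Mq)" "s < dim_col (c \<cdot>\<^sub>m 1\<^sub>m n + q ^ J \<cdot>\<^sub>m ?Mq)"
    then have rs: "r < n" "s < n" using M by auto
    have "poly (?W $$ (r, s)) q = poly (poly_cutoff J (?W $$ (r, s))) q + q ^ J * poly (poly_shift J (?W $$ (r, s))) q"
      using arg_cong[OF poly_cutoff_shift[of "?W $$ (r, s)" J], of "\<lambda>p. poly p q"]
      by (simp only: poly_add poly_mult poly_monom mult_1)
    also have "poly (poly_cutoff J (?W $$ (r, s))) q = (if r = s then c else 0)"
      unfolding cut[OF rs] by (simp add: c_def)
    also have "poly_shift J (?W $$ (r, s)) = M $$ (r, s)" using rs by (simp add: M_def)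
    finally show "map_mat (\<lambda>p. poly p q) ?W $$ (r, s) = (c \<cdot>\<^sub>m 1\<^sub>m n + q ^ J \<cdot>\<^sub>m ?Mq) $$ (r, s)"
      using rs carrier_matD[OF M] carrier_matD[OF graded_eval_carrier[of n f a]] by simp
  qed (use M in \<open>auto simp: graded_eval_def\<close>)
  moreover have "map_mat (\<lambda>p. poly p q) ?W \<in> poly_image n f"
    unfolding map_graded_eval poly_image_def by auto
  moreover have "similar_mat B' (c \<cdot>\<^sub>m 1\<^sub>m n + q ^ J \<cdot>\<^sub>m ?Mq)"
    unfolding B'_def by (rule similar_mat_affine[OF similar_mat_sym[OF B(1)] B(2)])
  ultimately have "B' \<in> poly_image n f" using poly_image_similar by metis
  moreover have "upper_triangular B'"
    using B(2,3) by (intro upper_triangularI) (auto simp: B'_def upper_triangular_def)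
  moreover have "B' $$ (i, i) \<noteq> B' $$ (n div 2 + i, n div 2 + i)" if "i < n div 2" for i
  proof -
    have "i < n" "n div 2 + i < n" using that by auto
    then show ?thesis using B(2) B(4)[OF that] q(1) by (simp add: B'_def)
  qed
  ultimately show ?thesis by (rule that)
qed

theorem corollary3p19:
  fixes f :: "'a::{alg_closed_field, field_char_0} free_algebra"
    and n :: nat and T :: "'a mat"
  assumes "n \<ge> 2"
    and "\<not> polynomial_identity n f"
    and "\<not> central_polynomial n f"
    and "T \<in> carrier_mat n n"
    and "mat_trace T = 0"
  shows "\<exists>D\<^sub>1 \<in> poly_image_diff n f. \<exists>D\<^sub>2 \<in> poly_image_diff n f.
         \<exists>D\<^sub>3 \<in> poly_image_diff n f. \<exists>D\<^sub>4 \<in> poly_image_diff n f.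
           T = D\<^sub>1 + D\<^sub>2 + D\<^sub>3 + D\<^sub>4"
proof (rule traceless_sum_four)
  \<comment> \<open>A polynomial with only central values would be an identity or a central
    polynomial.\<close>
  have "\<not> poly_image n f \<subseteq> mat_center n"
    using assms(2,3) by (auto simp: central_polynomial_def)
  then obtain B where B: "B \<in> poly_image n f" "upper_triangular B"
    "\<And>i. i < n div 2 \<Longrightarrow> B $$ (i, i) \<noteq> B $$ (n div 2 + i, n div 2 + i)"
    using poly_image_distinct_halves[of n f] assms(1) by auto
  show "offset_unit_mat n (n div 2) r \<in> poly_image_diff n f" if "r \<le> n div 2" for r
    by (rule offset_unit_mat_in_poly_image_diff[OF B(1,2) _ that]) (use B(3) that in auto)
  show "poly_image_diff n f \<subseteq> carrier_mat n n" using poly_image_diff_carrier by blast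
  show "E \<in> poly_image_diff n f" if "D \<in> poly_image_diff n f" "similar_mat E D" for D E
    by (rule poly_image_diff_similar[OF that])
qed (use assms in auto)

end
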